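(* Suppose that one assigns to every polygon $P$ in the plane a point $C(P)\in\mathbb{R}^2$ (a "center") so that: (i) $C(P)$ depends analytically on the polygon $P$; (ii) $C$ commutes with dilations; (iii) $C$ satisfies the Archimedes Lemma: if $P=V_0V_1\dots V_{n-1}$ is cut along a polygonal line $V_0X_1\dots X_mV_k$ into the closed polygons $Q=V_0V_1\dots V_kX_m\dots X_1$ and $R=V_0X_1\dots X_mV_kV_{k+1}\dots V_{n-1}$, then $$C(P)=\frac{A(Q)\,C(Q)+A(R)\,C(R)}{A(Q)+A(R)}.$$ Then there is a $t$ such that $C(P)=C_t(P)$ for every polygon $P$.
   Context: A polygon $P=(V_0,\dots,V_{n-1})$ is a closed oriented polygon in $\mathbb{R}^2$ given by the cyclic sequence of its vertices (indices mod $n$). With $V_i=(x_i,y_i)$, its signed area is $A(P)=\tfrac12\sum_i (x_iy_{i+1}-x_{i+1}y_i)$. Polygons whose centers are considered are assumed to have nonzero signed area. "Commutes with dilations" means $C(\phi(P))=\phi(C(P))$ for every dilation $\phi$ of the plane. For $A(P)\neq0$ let $O$ be a point not on the sides of $P$ or their extensions and let $A_i$ be the signed area of the triangle $OV_iV_{i+1}$. The Circumcenter of Mass is $CCM(P)=\sum_i\frac{A_i}{A(P)}C_i$, where $C_i$ is the circumcenter of the triangle $OV_iV_{i+1}$, and the center of mass of the homogeneous lamina bounded by $P$ is $CM(P)=\sum_i\frac{A_i}{A(P)}G_i$, where $G_i$ is the centroid of $OV_iV_{i+1}$; neither depends on $O$. For a real number $t$, $$C_t(P)=t\,CM(P)+(1-t)\,CCM(P).$$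 For a given $P$, the points $C_t(P)$ form the generalized Euler line of $P$.
   Formalization: "Dilations" in (ii) are taken to be all similarities of the plane, including rotations and reflections; for homotheties only the claim fails, e.g. for C(P) = CM(P) + (Σ(x_{i+1}−x_i)³, 0)/A(P). *)

theory Defs
  imports "HOL-Analysis.Analysis"
begin

text \<open>
  A closed oriented polygon is given by the list of its vertices. Lists that differ by a
  rotation describe the same polygon, so that a point-valued function of polygons is a function
  of lists that is invariant under \<^const>\<open>rotate1\<close>. Polygons may intersect themselves and
  vertices may coincide; a nonzero signed area forces at least three vertices.
\<close>

definition signed_area :: "(real^2) list \<Rightarrow> real" where
  "signed_area P = (1/2) * (\<Sum>i<length P.
     P!i $ 1 * P!(Suc i mod length P) $ 2 - P!(Suc i mod length P) $ 1 * P!i $ 2)"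

definition centroid :: "real^2 \<Rightarrow> real^2 \<Rightarrow> real^2 \<Rightarrow> real^2" where
  "centroid a b c = (1/3) *\<^sub>R (a + b + c)"

definition circumcenter :: "real^2 \<Rightarrow> real^2 \<Rightarrow> real^2 \<Rightarrow> real^2" where
  "circumcenter a b c = (THE p. dist p a = dist p b \<and> dist p b = dist p c)"

definition base_point :: "(real^2) list \<Rightarrow> real^2 \<Rightarrow> bool" where
  "base_point P Z \<longleftrightarrow> (\<forall>i<length P. Z \<notin> affine hull {P!i, P!(Suc i mod length P)})"

text \<open>
  If two consecutive vertices coincide, the corresponding triangle with the base point has
  area 0 and no circumcenter; its term below is 0, whatever the value of
  \<^const>\<open>circumcenter\<close> there. The choice of the base point is immaterial, see the lemmas
  \<open>CM_eq\<close> and \<open>CCM_eq\<close>.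
\<close>

definition CM :: "(real^2) list \<Rightarrow> real^2" where
  "CM P = (let Z = (SOME Z. base_point P Z) in
     \<Sum>i<length P. (signed_area [Z, P!i, P!(Suc i mod length P)] / signed_area P) *\<^sub>R
       centroid Z (P!i) (P!(Suc i mod length P)))"

definition CCM :: "(real^2) list \<Rightarrow> real^2" where
  "CCM P = (let Z = (SOME Z. base_point P Z) in
     \<Sum>i<length P. (signed_area [Z, P!i, P!(Suc i mod length P)] / signed_area P) *\<^sub>R
       circumcenter Z (P!i) (P!(Suc i mod length P)))"

definition euler_center :: "real \<Rightarrow> (real^2) list \<Rightarrow> real^2" where
  "euler_center t P = t *\<^sub>R CM P + (1 - t) *\<^sub>R CCM P"

text \<open>
  Real analyticity at \<open>P\<close> in the \<open>2n\<close> coordinates of the vertices of polygons with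
  \<open>n = length P\<close> vertices: near \<open>P\<close> the function is the sum of an (unconditionally, hence
  absolutely) convergent power series. A multi-index assigns an exponent to the \<open>j\<close>-th
  coordinate of the \<open>i\<close>-th vertex.
\<close>

definition real_analytic_at :: "((real^2) list \<Rightarrow> real^2) \<Rightarrow> (real^2) list \<Rightarrow> bool" where
  "real_analytic_at f P \<longleftrightarrow>
     (\<exists>r>0. \<exists>c :: (nat \<times> 2 \<Rightarrow> nat) \<Rightarrow> real^2.
        \<forall>Q. length Q = length P \<and> (\<forall>i<length P. dist (Q!i) (P!i) < r) \<longrightarrow>
          ((\<lambda>\<alpha>. (\<Prod>(i, j)\<in>{..<length P} \<times> UNIV. (Q!i $ j - P!i $ j) ^ \<alpha> (i, j)) *\<^sub>R c \<alpha>)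
             has_sum f Q) {\<alpha>. \<forall>p. p \<notin> {..<length P} \<times> UNIV \<longrightarrow> \<alpha> p = 0})"

text \<open>
  Dilations are taken in the sense of metric geometry: maps that multiply all distances by one
  positive factor, i.e. all similarities, including rotations and reflections. Homotheties
  (the maps \<open>x \<mapsto> \<lambda>x + b\<close>) alone do not suffice to characterize the Euler line: adding to
  \<open>CM P\<close> the vector with coordinates \<open>\<Sum>i. (x\<^sub>i\<^sub>+\<^sub>1 - x\<^sub>i)\<^sup>3 / signed_area P\<close> and \<open>0\<close> gives
  a center that is analytic, satisfies the Archimedes Lemma and commutes with homotheties.
\<close>

definition dilation :: "(real^2 \<Rightarrow> real^2) \<Rightarrow> bool" where
  "dilation \<phi> \<longleftrightarrow> (\<exists>r>0. \<forall>x y. dist (\<phi> x) (\<phi> y) = r * dist x y)"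


lemma signed_area_triangle:
  "signed_area [a, b, c] =
     ((b$1 - a$1) * (c$2 - a$2) - (c$1 - a$1) * (b$2 - a$2)) / 2"
  by (simp add: signed_area_def) algebra

lemma base_point_exists: "\<exists>Z. base_point P Z"
proof -
  have "negligible (\<Union>i<length P. affine hull {P!i, P!(Suc i mod length P)})"
  proof (rule negligible_Union)
    show "finite ((\<lambda>i. affine hull {P!i, P!(Suc i mod length P)}) ` {..<length P})"
      by simp
  next
    fix t assume "t \<in> (\<lambda>i. affine hull {P!i, P!(Suc i mod length P)}) ` {..<length P}"
    then obtain a b where t: "t = affine hull {a, b}" by blast
    have "interior t = {}"
      unfolding t by (rule empty_interior_affine_hull) (auto simp: card_insert_if)
    then show "negligible t"
      using negligible_convex_interior convex_affine_hull t by blast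
  qed
  then have "(\<Union>i<length P. affine hull {P!i, P!(Suc i mod length P)}) \<noteq> UNIV"
    using non_negligible_UNIV by metis
  then show ?thesis
    unfolding base_point_def by blast
qed

lemma circumcenter_coords:
  assumes "signed_area [a, b, c] \<noteq> 0"
  shows "4 * signed_area [a, b, c] * circumcenter a b c $ 1 =
      (a \<bullet> a) * (b$2 - c$2) + (b \<bullet> b) * (c$2 - a$2) + (c \<bullet> c) * (a$2 - b$2)" (is ?x)
    and "4 * signed_area [a, b, c] * circumcenter a b c $ 2 =
      (a \<bullet> a) * (c$1 - b$1) + (b \<bullet> b) * (a$1 - c$1) + (c \<bullet> c) * (b$1 - a$1)" (is ?y)
    and "dist (circumcenter a b c) a = dist (circumcenter a b c) b"
    and "dist (circumcenter a b c) b = dist (circumcenter a b c) c"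
proof -
  define D where "D = 4 * signed_area [a, b, c]"
  define X where "X = (a \<bullet> a) * (b$2 - c$2) + (b \<bullet> b) * (c$2 - a$2) + (c \<bullet> c) * (a$2 - b$2)"
  define Y where "Y = (a \<bullet> a) * (c$1 - b$1) + (b \<bullet> b) * (a$1 - c$1) + (c \<bullet> c) * (b$1 - a$1)"
  have D: "D = 2 * ((b$1 - a$1) * (c$2 - a$2) - (c$1 - a$1) * (b$2 - a$2))" "D \<noteq> 0"
    using assms by (simp_all add: D_def signed_area_triangle)
  have dist: "dist p u = dist p v \<longleftrightarrow>
      2 * (p$1 * (v$1 - u$1) + p$2 * (v$2 - u$2)) = v \<bullet> v - u \<bullet> u" for p u v :: "real^2"
    by (simp add: dist_norm norm_eq inner_vec_def sum_2 algebra_simps)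
  have key: "dist p a = dist p b \<and> dist p b = dist p c \<longleftrightarrow> D * p$1 = X \<and> D * p$2 = Y" for p
  proof
    assume "dist p a = dist p b \<and> dist p b = dist p c"
    then have e: "2 * (p$1 * (b$1 - a$1) + p$2 * (b$2 - a$2)) = b \<bullet> b - a \<bullet> a"
      "2 * (p$1 * (c$1 - b$1) + p$2 * (c$2 - b$2)) = c \<bullet> c - b \<bullet> b"
      by (simp_all only: dist)
    show "D * p$1 = X \<and> D * p$2 = Y"
      unfolding D X_def Y_def using e by algebra
  next
    assume p: "D * p$1 = X \<and> D * p$2 = Y"
    have "D * (2 * (p$1 * (b$1 - a$1) + p$2 * (b$2 - a$2))) = D * (b \<bullet> b - a \<bullet> a)"
      "D * (2 * (p$1 * (c$1 - b$1) + p$2 * (c$2 - b$2))) = D * (c \<bullet> c - b \<bullet> b)"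
      using p unfolding D(1) X_def Y_def by algebra+
    then show "dist p a = dist p b \<and> dist p b = dist p c"
      unfolding dist using D(2) by simp
  qed
  have "\<exists>!p. dist p a = dist p b \<and> dist p b = dist p c"
  proof (rule ex1I)
    show "dist (vector [X / D, Y / D]) a = dist (vector [X / D, Y / D]) b \<and>
        dist (vector [X / D, Y / D]) b = dist (vector [X / D, Y / D]) c"
      unfolding key using D(2) by simp
  next
    fix p assume "dist p a = dist p b \<and> dist p b = dist p c"
    then show "p = vector [X / D, Y / D]"
      unfolding key using D(2) by (auto simp: vec_eq_iff forall_2 field_simps)
  qed
  from theI'[OF this]
  have *: "dist (circumcenter a b c) a = dist (circumcenter a b c) b \<and>
      dist (circumcenter a b c) b = dist (circumcenter a b c) c"
    unfolding circumcenter_def .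
  then show "dist (circumcenter a b c) a = dist (circumcenter a b c) b"
    "dist (circumcenter a b c) b = dist (circumcenter a b c) c" by auto
  show ?x ?y
    using * unfolding key by (simp_all add: D_def X_def Y_def)
qed

lemma base_point_area:
  assumes "base_point P Z" "i < length P" "P!i \<noteq> P!(Suc i mod length P)"
  shows "signed_area [Z, P!i, P!(Suc i mod length P)] \<noteq> 0"
proof
  define a b where "a = P!i" and "b = P!(Suc i mod length P)"
  assume "signed_area [Z, P!i, P!(Suc i mod length P)] = 0"
  then have e: "(b$1 - a$1) * (Z$2 - a$2) = (Z$1 - a$1) * (b$2 - a$2)"
    unfolding signed_area_triangle a_def[symmetric] b_def[symmetric] by algebra
  have "\<exists>u. Z = a + u *\<^sub>R (b - a)"
  proof (cases "b$1 = a$1")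
    case True
    then have ne: "b$2 \<noteq> a$2"
      using assms(3) by (auto simp: a_def b_def vec_eq_iff forall_2)
    with e True have "Z$1 = a$1" by simp
    with True ne have "Z = a + ((Z$2 - a$2) / (b$2 - a$2)) *\<^sub>R (b - a)"
      by (simp add: vec_eq_iff forall_2)
    then show ?thesis ..
  next
    case False
    have "y = x / d * w" if "d * y = x * w" "d \<noteq> 0" for x y d w :: real
      using that by (simp add: eq_divide_eq mult.commute)
    from this[OF e] False have "Z$2 - a$2 = (Z$1 - a$1) / (b$1 - a$1) * (b$2 - a$2)"
      by simp
    with False have "Z = a + ((Z$1 - a$1) / (b$1 - a$1)) *\<^sub>R (b - a)"
      by (simp add: vec_eq_iff forall_2)
    then show ?thesis ..
  qed
  then have "Z \<in> affine hull {a, b}"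
    by (auto simp: affine_hull_2_alt)
  then show False
    using assms(1,2) by (auto simp: base_point_def a_def b_def)
qed

lemma sum_cyclic_telescope:
  fixes q :: "'a \<Rightarrow> 'b::ab_group_add"
  shows "(\<Sum>i<length P. q (P!i) - q (P!(Suc i mod length P))) = 0"
proof (cases "length P")
  case (Suc n)
  have "(\<Sum>i<Suc n. q (P!(Suc i mod Suc n))) = (\<Sum>i<n. q (P!Suc i)) + q (P!0)"
    by simp
  also have "\<dots> = (\<Sum>i<Suc n. q (P!i))"
    by (subst sum.lessThan_Suc_shift) (simp add: add.commute)
  finally show ?thesis
    using Suc by (simp add: sum_subtractf del: sum.lessThan_Suc)
qed simp

lemma sum_centroid:
  "(\<Sum>i<length P. signed_area [Z, P!i, P!(Suc i mod length P)] *\<^sub>R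
      centroid Z (P!i) (P!(Suc i mod length P))) =
   (\<Sum>i<length P. signed_area [0, P!i, P!(Suc i mod length P)] *\<^sub>R
      centroid 0 (P!i) (P!(Suc i mod length P)))"
proof -
  define q where "q V = signed_area [0, Z, V] *\<^sub>R centroid 0 Z V" for V
  have "signed_area [Z, V, W] *\<^sub>R centroid Z V W =
      signed_area [0, V, W] *\<^sub>R centroid 0 V W + (q V - q W)" for V W
    unfolding q_def signed_area_triangle centroid_def vec_eq_iff forall_2
    by (simp add: field_simps)
  then show ?thesis
    by (simp only: sum.distrib sum_cyclic_telescope add_0_right)
qed

text \<open>
  Contribution of an oriented edge to \<open>signed_area P *\<^sub>R CCM P\<close>; its sum over the three edges of
  a triangle is the area times the circumcenter.
\<close>

definition ccm_edge :: "real^2 \<Rightarrow> real^2 \<Rightarrow> real^2" where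
  "ccm_edge V W = (1/4) *\<^sub>R ((V \<bullet> V) *\<^sub>R vector [W$2, - W$1] - (W \<bullet> W) *\<^sub>R vector [V$2, - V$1])"

lemma ccm_edge_self: "ccm_edge V V = 0"
  by (simp add: ccm_edge_def)

lemma signed_area_degenerate: "signed_area [Z, V, V] = 0"
  by (simp add: signed_area_triangle)

lemma sum_circumcenter:
  assumes "base_point P Z"
  shows "(\<Sum>i<length P. signed_area [Z, P!i, P!(Suc i mod length P)] *\<^sub>R
      circumcenter Z (P!i) (P!(Suc i mod length P))) =
   (\<Sum>i<length P. ccm_edge (P!i) (P!(Suc i mod length P)))"
proof -
  let ?W = "\<lambda>i. P!(Suc i mod length P)"
  define q where "q V = ccm_edge Z V" for V
  have *: "signed_area [Z, P!i, ?W i] *\<^sub>R circumcenter Z (P!i) (?W i) =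
      ccm_edge (P!i) (?W i) + (q (P!i) - q (?W i))" if i: "i < length P" for i
  proof (cases "P!i = ?W i")
    case True
    then show ?thesis
      unfolding True by (simp only: ccm_edge_self signed_area_degenerate scaleR_zero_left
          diff_self add_0_right)
  next
    case False
    define V W where "V = P!i" and "W = ?W i"
    have nz: "signed_area [Z, V, W] \<noteq> 0"
      using base_point_area[OF assms i False] by (simp add: V_def W_def)
    have e: "signed_area [Z, V, W] * circumcenter Z V W $ 1 = (ccm_edge V W + (q V - q W)) $ 1"
      "signed_area [Z, V, W] * circumcenter Z V W $ 2 = (ccm_edge V W + (q V - q W)) $ 2"
      using circumcenter_coords(1,2)[OF nz]
      by (simp_all add: q_def ccm_edge_def algebra_simps)
    then show ?thesis
      unfolding V_def[symmetric] W_def[symmetric] vec_eq_iff forall_2 by simp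
  qed
  have "(\<Sum>i<length P. signed_area [Z, P!i, ?W i] *\<^sub>R circumcenter Z (P!i) (?W i)) =
      (\<Sum>i<length P. ccm_edge (P!i) (?W i) + (q (P!i) - q (?W i)))"
    by (rule sum.cong) (use * in auto)
  then show ?thesis
    by (simp only: sum.distrib sum_cyclic_telescope add_0_right)
qed

lemma CM_eq:
  "CM P = (\<Sum>i<length P. (signed_area [Z, P!i, P!(Suc i mod length P)] / signed_area P) *\<^sub>R
       centroid Z (P!i) (P!(Suc i mod length P)))"
proof -
  have "(\<Sum>i<length P. (signed_area [Z, P!i, P!(Suc i mod length P)] / signed_area P) *\<^sub>R
       centroid Z (P!i) (P!(Suc i mod length P))) =
    (1 / signed_area P) *\<^sub>R (\<Sum>i<length P. signed_area [Z, P!i, P!(Suc i mod length P)] *\<^sub>R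
      centroid Z (P!i) (P!(Suc i mod length P)))" for Z
    by (simp add: scaleR_sum_right)
  then show ?thesis
    unfolding CM_def Let_def
    by (simp only: sum_centroid[of Z P] sum_centroid[of "SOME Z. base_point P Z" P])
qed

lemma CCM_eq:
  assumes "base_point P Z"
  shows "CCM P =
     (\<Sum>i<length P. (signed_area [Z, P!i, P!(Suc i mod length P)] / signed_area P) *\<^sub>R
       circumcenter Z (P!i) (P!(Suc i mod length P)))"
proof -
  have "(\<Sum>i<length P. (signed_area [Z, P!i, P!(Suc i mod length P)] / signed_area P) *\<^sub>R
       circumcenter Z (P!i) (P!(Suc i mod length P))) =
    (1 / signed_area P) *\<^sub>R (\<Sum>i<length P. signed_area [Z, P!i, P!(Suc i mod length P)] *\<^sub>R
      circumcenter Z (P!i) (P!(Suc i mod length P)))" for Z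
    by (simp add: scaleR_sum_right)
  then show ?thesis
    unfolding CCM_def Let_def
    by (simp only: sum_circumcenter[OF assms] sum_circumcenter[OF someI_ex[OF base_point_exists]])
qed

end

theory Submission
  imports Defs
begin

text \<open>
  Put \<open>M P = signed_area P *\<^sub>R C P\<close>; by the Archimedes Lemma \<open>M\<close> is additive under cuts. The
  degenerating triangles \<open>0, s v, s w\<close> are attached to the fixed triangle \<open>0, e1, e2\<close>, so
  \<open>s\<^sup>3 M [0, v, w] = M [0, e1, e2, s v, s w] - M [0, e1, e2, s v]\<close>. Comparing the coefficients of
  \<open>s\<^sup>3\<close> in the Taylor expansions shows that \<open>M [0, v, w]\<close> is a cubic form in \<open>(v, w)\<close>. Equivariance
  under similarities leaves six real coefficients; invariance under cyclic rotation and the two ways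
  of cutting one quadrilateral along a diagonal leave one, which is the parameter of the Euler line.
  General polygons are cut into triangles after a small perturbation.
\<close>

section \<open>Homogeneous polynomial maps and Taylor expansion\<close>

text \<open>Homogeneous polynomial maps of degree \<open>k\<close>, generated by linear functionals
  instead of coordinates: the domain may be any real vector space, and induction on the derivation
  produces multilinear forms.\<close>

inductive hpoly :: "nat \<Rightarrow> ('v::real_vector \<Rightarrow> 'b::real_vector) \<Rightarrow> bool" where
  const: "hpoly 0 (\<lambda>_. c)"
| mult: "linear l \<Longrightarrow> hpoly k f \<Longrightarrow> hpoly (Suc k) (\<lambda>x. l x *\<^sub>R f x)" for l :: "'v \<Rightarrow> real"
| add: "hpoly k f \<Longrightarrow> hpoly k g \<Longrightarrow> hpoly k (\<lambda>x. f x + g x)"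

lemma hpoly_scaleR: "hpoly k f \<Longrightarrow> hpoly k (\<lambda>x. a *\<^sub>R f x)"
proof (induction rule: hpoly.induct)
  case (const c)
  show ?case by (rule hpoly.const)
next
  case (mult l k f)
  from hpoly.mult[OF mult(1,3)] show ?case
    by (simp add: mult.commute)
next
  case (add k f g)
  from hpoly.add[OF add(3,4)] show ?case
    by (simp add: scaleR_add_right)
qed

lemma hpoly_diff: "hpoly k f \<Longrightarrow> hpoly k g \<Longrightarrow> hpoly k (\<lambda>x. f x - g x)"
  using hpoly.add[OF _ hpoly_scaleR[of k g "-1"]] by simp

lemma hpoly_zero: "hpoly k (\<lambda>_. 0)"
proof (induction k)
  case (Suc k)
  from hpoly.mult[OF module_hom_zero Suc] show ?case by simp
qed (rule hpoly.const)

lemma hpoly_sum: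
  assumes "\<And>a. a \<in> A \<Longrightarrow> hpoly k (f a)"
  shows "hpoly k (\<lambda>x. \<Sum>a\<in>A. f a x)"
  using assms
  by (induction A rule: infinite_finite_induct) (simp_all add: hpoly_zero hpoly.add)

lemma hpoly_power:
  assumes "linear l" "hpoly k f"
  shows "hpoly (m + k) (\<lambda>x. l x ^ m *\<^sub>R f x)"
proof (induction m)
  case (Suc m)
  from hpoly.mult[OF assms(1) Suc] show ?case by simp
qed (simp add: assms)

lemma hpoly_monomial:
  assumes "finite A" "\<And>p. p \<in> A \<Longrightarrow> linear (l p)"
  shows "hpoly (\<Sum>p\<in>A. m p) (\<lambda>x. (\<Prod>p\<in>A. l p x ^ m p) *\<^sub>R c)"
  using assms
proof (induction A rule: finite_induct)
  case (insert p A)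
  have "hpoly (m p + (\<Sum>p\<in>A. m p)) (\<lambda>x. l p x ^ m p *\<^sub>R (\<Prod>p\<in>A. l p x ^ m p) *\<^sub>R c)"
    by (rule hpoly_power) (use insert in auto)
  with insert.hyps show ?case by simp
qed (simp add: hpoly.const)

lemma hpoly_0_const: "hpoly k f \<Longrightarrow> k = 0 \<Longrightarrow> f x = f y"
  by (induction rule: hpoly.induct) simp_all

lemma hpoly_1_linear: "hpoly k f \<Longrightarrow> k = 1 \<Longrightarrow> linear f"
proof (induction rule: hpoly.induct)
  case (mult l k f)
  define c where "c = f 0"
  have "f = (\<lambda>_. c)"
    unfolding c_def using mult by (intro ext hpoly_0_const[of k]) simp_all
  then show ?case
    using mult(1) by (simp add: linear_iff algebra_simps)
qed (auto intro: linear_compose_add)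

text \<open>Each product splits into its first functional and a linear rest. The form
  \<open>B\<close> need not be symmetric, since only its diagonal is prescribed.\<close>

lemma hpoly_2_bilinear:
  "hpoly k f \<Longrightarrow> k = 2 \<Longrightarrow>
    \<exists>B. (\<forall>x. linear (B x)) \<and> (\<forall>y. linear (\<lambda>x. B x y)) \<and> (\<forall>x. f x = B x x)"
proof (induction rule: hpoly.induct)
  case (mult l k f)
  then have "linear f"
    using hpoly_1_linear by (metis One_nat_def Suc_1 Suc_inject)
  then show ?case
    using mult(1) by (intro exI[of _ "\<lambda>x y. l x *\<^sub>R f y"]) (simp add: linear_iff algebra_simps)
next
  case (add k f g)
  then obtain B B' where "\<forall>x. linear (B x)" "\<forall>y. linear (\<lambda>x. B x y)" "\<forall>x. f x = B x x"
    "\<forall>x. linear (B' x)" "\<forall>y. linear (\<lambda>x. B' x y)" "\<forall>x. g x = B' x x"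
    by blast
  then show ?case
    by (intro exI[of _ "\<lambda>x y. B x y + B' x y"]) (simp add: linear_compose_add)
qed simp

lemma hpoly_3_trilinear:
  "hpoly k f \<Longrightarrow> k = 3 \<Longrightarrow>
    \<exists>T. (\<forall>x y. linear (T x y)) \<and> (\<forall>x z. linear (\<lambda>y. T x y z)) \<and> (\<forall>y z. linear (\<lambda>x. T x y z)) \<and>
      (\<forall>x. f x = T x x x)"
proof (induction rule: hpoly.induct)
  case (mult l k f)
  then obtain B where "\<forall>x. linear (B x)" "\<forall>y. linear (\<lambda>x. B x y)" "\<forall>x. f x = B x x"
    using hpoly_2_bilinear[of k f] by auto
  then show ?case
    using mult(1) by (intro exI[of _ "\<lambda>x y z. l x *\<^sub>R B y z"]) (simp add: linear_iff algebra_simps)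
next
  case (add k f g)
  then obtain B B' where
    "\<forall>x y. linear (B x y)" "\<forall>x z. linear (\<lambda>y. B x y z)" "\<forall>y z. linear (\<lambda>x. B x y z)" "\<forall>x. f x = B x x x"
    "\<forall>x y. linear (B' x y)" "\<forall>x z. linear (\<lambda>y. B' x y z)" "\<forall>y z. linear (\<lambda>x. B' x y z)" "\<forall>x. g x = B' x x x"
    by blast
  then show ?case
    by (intro exI[of _ "\<lambda>x y z. B x y z + B' x y z"]) (simp add: linear_compose_add)
qed simp

section \<open>Taylor expansion to third order along linearly varying directions\<close>

lemma summable_on_imp_abs_summable_on_euclidean:
  fixes f :: "'a \<Rightarrow> 'b::euclidean_space"
  assumes "f summable_on A"
  shows "(\<lambda>x. norm (f x)) summable_on A"
proof -
  \<comment> \<open>For real families summability and absolute summability agree, so the claim is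
    reduced to coordinates.\<close>
  have "(\<lambda>x. norm (f x \<bullet> b)) summable_on A" for b
    by (rule summable_on_iff_abs_summable_on_real[THEN iffD1])
      (rule summable_on_bounded_linear[OF bounded_linear_inner_left assms])
  then have "(\<lambda>x. \<Sum>b\<in>B. norm (f x \<bullet> b)) summable_on A" for B
    by (induction B rule: infinite_finite_induct) (simp_all add: summable_on_add)
  from this[of Basis] show ?thesis
    by (rule Infinite_Sum.abs_summable_on_comparison_test') (simp add: norm_le_l1)
qed

text \<open>On a line through \<open>P\<close> the power series becomes a series in
  \<open>s\<close>. Its coefficient at \<open>s^k\<close> collects the monomials of degree
  \<open>k\<close> and is therefore homogeneous of degree \<open>k\<close> in the parameter
  \<open>x\<close> of the direction.\<close>

lemma taylor_expansion:
  fixes f :: "(real^2) list \<Rightarrow> real^2" and d :: "'v::real_vector \<Rightarrow> nat \<Rightarrow> real^2"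
  assumes "real_analytic_at f P" "\<And>i. linear (\<lambda>x. d x i)"
  shows "\<exists>p. (\<forall>k. hpoly k (p k)) \<and>
    (\<forall>x. ((\<lambda>s. (f (map (\<lambda>i. P!i + s *\<^sub>R d x i) [0..<length P]) - (\<Sum>k<4. s^k *\<^sub>R p k x)) /\<^sub>R s^3)
      \<longlongrightarrow> 0) (at_right 0))"
proof -
  define I :: "(nat \<times> 2) set" where "I = {..<length P} \<times> UNIV"
  define S :: "(nat \<times> 2 \<Rightarrow> nat) set" where "S = {\<alpha>. \<forall>p. p \<notin> I \<longrightarrow> \<alpha> p = 0}"
  define deg where "deg \<alpha> = (\<Sum>p\<in>I. \<alpha> p)" for \<alpha> :: "nat \<times> 2 \<Rightarrow> nat"
  define l where "l p x = d x (fst p) $ snd p" for p :: "nat \<times> 2" and x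
  have finI: "finite I" by (simp add: I_def)
  obtain r c where r: "r > 0" and c: "\<And>Q. length Q = length P \<Longrightarrow>
      (\<And>i. i < length P \<Longrightarrow> dist (Q!i) (P!i) < r) \<Longrightarrow>
      ((\<lambda>\<alpha>. (\<Prod>(i, j)\<in>I. (Q!i $ j - P!i $ j) ^ \<alpha> (i, j)) *\<^sub>R c \<alpha>) has_sum f Q) S"
    using assms(1) unfolding real_analytic_at_def I_def S_def by blast
  define g where "g x \<alpha> = (\<Prod>p\<in>I. l p x ^ \<alpha> p) *\<^sub>R c \<alpha>" for x \<alpha>
  define p where "p k x = (\<Sum>\<alpha>\<in>{\<alpha>\<in>S. deg \<alpha> = k}. g x \<alpha>)" for k x
  define L where "L = {\<alpha>\<in>S. deg \<alpha> < 4}"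
  have hp: "hpoly k (p k)" for k
    unfolding p_def
  proof (rule hpoly_sum)
    fix \<alpha> assume "\<alpha> \<in> {\<alpha>\<in>S. deg \<alpha> = k}"
    then have k: "k = (\<Sum>p\<in>I. \<alpha> p)" by (simp add: deg_def)
    have "linear (l p)" for p
    proof -
      have "linear (\<lambda>v::real^2. v $ snd p)"
        by (simp add: linear_iff)
      from linear_compose[OF assms(2)[of "fst p"] this] show ?thesis
        by (simp add: l_def[abs_def] o_def)
    qed
    then show "hpoly k (\<lambda>x. g x \<alpha>)"
      unfolding g_def k by (intro hpoly_monomial finI)
  qed
  \<comment> \<open>Each exponent is at most the degree, so only finitely many multi-indices have
    degree below 4.\<close>
  have "L \<subseteq> {\<alpha>. \<forall>p. (p \<in> I \<longrightarrow> \<alpha> p \<in> {..<4}) \<and> (p \<notin> I \<longrightarrow> \<alpha> p = 0)}"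
  proof (clarsimp simp: L_def S_def)
    fix \<alpha> i j assume "deg \<alpha> < 4" "(i, j) \<in> I"
    then show "\<alpha> (i, j) < 4"
      using member_le_sum[of "(i, j)" I \<alpha>] finI by (simp add: deg_def)
  qed
  then have finL: "finite L"
    by (rule finite_subset) (use finI in \<open>intro finite_set_of_finite_funs; simp\<close>)
  have "((\<lambda>s. (f (map (\<lambda>i. P!i + s *\<^sub>R d x i) [0..<length P]) - (\<Sum>k<4. s^k *\<^sub>R p k x)) /\<^sub>R s^3)
      \<longlongrightarrow> 0) (at_right 0)" for x
  proof -
    define F where "F s = f (map (\<lambda>i. P!i + s *\<^sub>R d x i) [0..<length P])" for s
    \<comment> \<open>For \<open>s \<le> s0\<close> every vertex moves by less than
      \<open>r\<close>; the summand 1 keeps the denominator positive when all directions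
      vanish.\<close>
    define s0 where "s0 = r / (1 + (\<Sum>i<length P. norm (d x i)))"
    have pos: "1 + (\<Sum>i<length P. norm (d x i)) > 0"
      by (simp add: add_pos_nonneg sum_nonneg)
    then have s0: "s0 > 0" using r by (simp add: s0_def)
    have sum: "((\<lambda>\<alpha>. s ^ deg \<alpha> *\<^sub>R g x \<alpha>) has_sum F s) S" if "0 \<le> s" "s \<le> s0" for s
    proof -
      have "s * norm (d x i) < r" if "i < length P" for i
      proof -
        have "norm (d x i) \<le> (\<Sum>i<length P. norm (d x i))"
          using that by (intro member_le_sum) auto
        then have "s * norm (d x i) \<le> s0 * (\<Sum>i<length P. norm (d x i))"
          using \<open>0 \<le> s\<close> \<open>s \<le> s0\<close> by (intro mult_mono) auto
        also have "\<dots> < s0 * (1 + (\<Sum>i<length P. norm (d x i)))"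
          using s0 by simp
        also have "\<dots> = r" using pos by (simp add: s0_def)
        finally show ?thesis .
      qed
      then have "((\<lambda>\<alpha>. (\<Prod>(i, j)\<in>I. (map (\<lambda>i. P!i + s *\<^sub>R d x i) [0..<length P]!i $ j - P!i $ j) ^ \<alpha> (i, j))
          *\<^sub>R c \<alpha>) has_sum F s) S"
        unfolding F_def using \<open>0 \<le> s\<close> by (intro c) (simp_all add: dist_norm)
      moreover have "(\<Prod>(i, j)\<in>I. (map (\<lambda>i. P!i + s *\<^sub>R d x i) [0..<length P]!i $ j - P!i $ j) ^ \<alpha> (i, j))
          *\<^sub>R c \<alpha> = s ^ deg \<alpha> *\<^sub>R g x \<alpha>" for \<alpha>
      proof -
        have "(\<Prod>(i, j)\<in>I. (map (\<lambda>i. P!i + s *\<^sub>R d x i) [0..<length P]!i $ j - P!i $ j) ^ \<alpha> (i, j)) =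
            (\<Prod>p\<in>I. (s * l p x) ^ \<alpha> p)"
          by (rule prod.cong) (auto simp: I_def l_def)
        then show ?thesis
          by (simp add: g_def deg_def power_sum power_mult_distrib prod.distrib)
      qed
      ultimately show ?thesis by simp
    qed
    \<comment> \<open>Absolute convergence at the single value \<open>s0\<close> will dominate the
      tail for all smaller \<open>s\<close>.\<close>
    have absS: "(\<lambda>\<alpha>. norm (s0 ^ deg \<alpha> *\<^sub>R g x \<alpha>)) summable_on S"
      using sum[of s0] s0 by (intro summable_on_imp_abs_summable_on_euclidean) (auto simp: summable_on_def)
    then have "(\<lambda>\<alpha>. norm (s0 ^ deg \<alpha> *\<^sub>R g x \<alpha>)) summable_on (S - L)"
      by (rule summable_on_subset_banach) auto
    then obtain K where K: "((\<lambda>\<alpha>. norm (s0 ^ deg \<alpha> *\<^sub>R g x \<alpha>)) has_sum K) (S - L)"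
      by (auto simp: summable_on_def)
    have low: "(\<Sum>\<alpha>\<in>L. s ^ deg \<alpha> *\<^sub>R g x \<alpha>) = (\<Sum>k<4. s^k *\<^sub>R p k x)" for s
    proof -
      have "(\<Sum>k<4. s^k *\<^sub>R p k x) = (\<Sum>k<4. \<Sum>\<alpha>\<in>{\<alpha>\<in>L. deg \<alpha> = k}. s ^ deg \<alpha> *\<^sub>R g x \<alpha>)"
      proof (rule sum.cong[OF refl])
        fix k :: nat assume "k \<in> {..<4}"
        then have "{\<alpha>\<in>L. deg \<alpha> = k} = {\<alpha>\<in>S. deg \<alpha> = k}" by (auto simp: L_def)
        then show "s^k *\<^sub>R p k x = (\<Sum>\<alpha>\<in>{\<alpha>\<in>L. deg \<alpha> = k}. s ^ deg \<alpha> *\<^sub>R g x \<alpha>)"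
          by (simp add: p_def scaleR_sum_right)
      qed
      also have "\<dots> = (\<Sum>\<alpha>\<in>L. s ^ deg \<alpha> *\<^sub>R g x \<alpha>)"
        by (rule sum.group[OF finL]) (auto simp: L_def)
      finally show ?thesis by simp
    qed
    \<comment> \<open>Outside \<open>L\<close> the degree is at least 4 and \<open>s / s0\<close> is
      at most 1, so each term is at most \<open>(s / s0)^4\<close> times its norm at
      \<open>s0\<close>; division by \<open>s^3\<close> leaves one factor \<open>s\<close>.\<close>
    have bound: "norm ((F s - (\<Sum>k<4. s^k *\<^sub>R p k x)) /\<^sub>R s^3) \<le> s * (K / s0^4)" if s: "0 < s" "s \<le> s0" for s
    proof -
      have "((\<lambda>\<alpha>. s ^ deg \<alpha> *\<^sub>R g x \<alpha>) has_sum (F s - (\<Sum>k<4. s^k *\<^sub>R p k x))) (S - L)"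
        unfolding low[symmetric]
        by (rule has_sum_Diff) (use sum s finL in \<open>auto simp: L_def\<close>)
      moreover have "((\<lambda>\<alpha>. (s / s0)^4 * norm (s0 ^ deg \<alpha> *\<^sub>R g x \<alpha>)) has_sum (s / s0)^4 * K) (S - L)"
        using K by (rule has_sum_cmult_right)
      moreover have "norm (s ^ deg \<alpha> *\<^sub>R g x \<alpha>) \<le> (s / s0)^4 * norm (s0 ^ deg \<alpha> *\<^sub>R g x \<alpha>)"
        if "\<alpha> \<in> S - L" for \<alpha>
      proof -
        have "(s / s0) ^ deg \<alpha> \<le> (s / s0) ^ 4"
          using that s s0 by (intro power_decreasing) (auto simp: L_def)
        then have "(s / s0) ^ deg \<alpha> * (s0 ^ deg \<alpha> * norm (g x \<alpha>)) \<le> (s / s0) ^ 4 * (s0 ^ deg \<alpha> * norm (g x \<alpha>))"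
          using s0 by (intro mult_right_mono) auto
        then show ?thesis
          using s s0 by (simp add: power_divide)
      qed
      ultimately have "norm (F s - (\<Sum>k<4. s^k *\<^sub>R p k x)) \<le> (s / s0)^4 * K"
        by (rule norm_infsum_le)
      then show ?thesis
        using s s0 by (simp add: divide_simps power_divide eval_nat_numeral mult_ac)
    qed
    have "((\<lambda>s. s * (K / s0^4)) \<longlongrightarrow> 0 * (K / s0^4)) (at_right 0)"
      by (intro tendsto_intros)
    then have lim: "((\<lambda>s. s * (K / s0^4)) \<longlongrightarrow> 0) (at_right 0)" by simp
    show ?thesis
      unfolding F_def[symmetric]
      by (rule Lim_null_comparison[OF _ lim])
        (use bound s0 in \<open>auto simp: eventually_at_right intro!: exI[of _ s0]\<close>)
  qed
  with hp show ?thesis by blast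
qed

section \<open>Sums over the edges of a polygon\<close>

text \<open>The signed area and the area times each Euler center are of this form, so additivity
  under cuts becomes antisymmetry of the edge function.\<close>

definition edge_sum :: "('a \<Rightarrow> 'a \<Rightarrow> 'b::ab_group_add) \<Rightarrow> 'a list \<Rightarrow> 'b" where
  "edge_sum f P = (\<Sum>i<length P. f (P!i) (P!(Suc i mod length P)))"

lemma edge_sum_path:
  assumes "P \<noteq> []"
  shows "edge_sum f P = (\<Sum>i<length P - 1. f (P!i) (P!Suc i)) + f (last P) (hd P)"
proof -
  from assms obtain n where n: "length P = Suc n" by (cases P) auto
  with assms show ?thesis
    by (simp add: edge_sum_def last_conv_nth hd_conv_nth)
qed

text \<open>The polygon and the attached triangle run through the common edge in opposite
  directions, so its two contributions cancel.\<close>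

lemma edge_sum_snoc:
  assumes "P \<noteq> []" "\<And>a b. f b a = - f a b"
  shows "edge_sum f (P @ [x]) = edge_sum f P + edge_sum f [hd P, last P, x]"
proof -
  from assms obtain n where n: "length P = Suc n" by (cases P) auto
  have "(\<Sum>i<n. f ((P @ [x])!i) ((P @ [x])!Suc i)) = (\<Sum>i<n. f (P!i) (P!Suc i))"
    by (rule sum.cong) (auto simp: nth_append n)
  moreover have "(P @ [x])!n = last P"
    using assms(1) by (simp add: nth_append n last_conv_nth)
  moreover have "(P @ [x])!Suc n = x"
    by (metis n nth_append_length)
  ultimately show ?thesis
    using assms(1) assms(2)[of "hd P" "last P"]
    by (simp add: edge_sum_path n numeral_2_eq_2)
qed

definition det2 :: "real^2 \<Rightarrow> real^2 \<Rightarrow> real" where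
  "det2 v w = v$1 * w$2 - w$1 * v$2"

lemma signed_area_edge_sum: "signed_area P = edge_sum det2 P / 2"
  by (simp add: signed_area_def edge_sum_def det2_def)

lemma signed_area_snoc:
  "P \<noteq> [] \<Longrightarrow> signed_area (P @ [x]) = signed_area P + signed_area [hd P, last P, x]"
  unfolding signed_area_edge_sum
  by (subst edge_sum_snoc) (simp_all add: det2_def add_divide_distrib)

lemma edge_sum_triangle: "edge_sum f [a, b, c] = f a b + f b c + f c a"
  by (simp add: edge_sum_path numeral_2_eq_2)

lemma edge_sum_quad: "edge_sum f [a, b, c, d] = f a b + f b c + f c d + f d a"
  by (simp add: edge_sum_path numeral_3_eq_3)

lemma edge_sum_pentagon: "edge_sum f [a, b, c, d, e] = f a b + f b c + f c d + f d e + f e a"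
  by (simp add: edge_sum_path numeral_eq_Suc)

lemma signed_area_0: "signed_area [0, v, w] = det2 v w / 2"
  by (simp add: signed_area_edge_sum edge_sum_triangle det2_def)

text \<open>The first term comes from the triangle \<open>0, V, W\<close>, with area
  \<open>det2 V W / 2\<close> and centroid \<open>(V + W) / 3\<close>. The second uses
  \<open>ccm_edge\<close> because \<open>0\<close> may lie on an extended side, where this triangle
  has no circumcenter.\<close>

definition euler_edge :: "real \<Rightarrow> real^2 \<Rightarrow> real^2 \<Rightarrow> real^2" where
  "euler_edge t V W = (t * det2 V W / 6) *\<^sub>R (V + W) + (1 - t) *\<^sub>R ccm_edge V W"

lemma euler_center_edge_sum:
  assumes "signed_area P \<noteq> 0"
  shows "signed_area P *\<^sub>R euler_center t P = edge_sum (euler_edge t) P"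
proof -
  have "signed_area P *\<^sub>R CM P = edge_sum (\<lambda>V W. (det2 V W / 6) *\<^sub>R (V + W)) P"
    using assms unfolding CM_eq[of P 0] edge_sum_def
    by (simp add: scaleR_sum_right signed_area_0 centroid_def)
  moreover have "signed_area P *\<^sub>R CCM P = edge_sum ccm_edge P"
    using sum_circumcenter[OF someI_ex[OF base_point_exists], of P] assms
    by (simp add: CCM_def Let_def scaleR_sum_right edge_sum_def)
  moreover have "edge_sum (euler_edge t) P =
      t *\<^sub>R edge_sum (\<lambda>V W. (det2 V W / 6) *\<^sub>R (V + W)) P + (1 - t) *\<^sub>R edge_sum ccm_edge P"
    by (simp add: edge_sum_def euler_edge_def sum.distrib scaleR_sum_right)
  moreover have "signed_area P *\<^sub>R euler_center t P =
      t *\<^sub>R (signed_area P *\<^sub>R CM P) + (1 - t) *\<^sub>R (signed_area P *\<^sub>R CCM P)"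
    by (simp add: euler_center_def scaleR_add_right mult.commute)
  ultimately show ?thesis by simp
qed

lemma euler_edge_swap: "euler_edge t W V = - euler_edge t V W"
proof -
  have "det2 W V = - det2 V W" "ccm_edge W V = - ccm_edge V W"
    by (simp_all add: det2_def ccm_edge_def vec_eq_iff forall_2 field_simps)
  then show ?thesis by (simp add: euler_edge_def add.commute)
qed

section \<open>Similarities of the plane\<close>

abbreviation e1 :: "real^2" where "e1 \<equiv> vector [1, 0]"
abbreviation e2 :: "real^2" where "e2 \<equiv> vector [0, 1]"

definition rot90 :: "real^2 \<Rightarrow> real^2" where
  "rot90 v = vector [- v$2, v$1]"

text \<open>In complex notation \<open>spiral u z\<close> is the product \<open>u z\<close> and \<open>reflect z\<close> is the conjugate of \<open>z\<close>.\<close>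

definition spiral :: "real^2 \<Rightarrow> real^2 \<Rightarrow> real^2" where
  "spiral u z = vector [u$1 * z$1 - u$2 * z$2, u$2 * z$1 + u$1 * z$2]"

definition reflect :: "real^2 \<Rightarrow> real^2" where
  "reflect z = vector [z$1, - z$2]"

lemma norm_spiral: "norm (spiral u z) = norm u * norm z"
proof -
  have "(norm (spiral u z))\<^sup>2 = (norm u * norm z)\<^sup>2"
    unfolding power_mult_distrib power2_norm_eq_inner
    by (simp add: spiral_def inner_vec_def sum_2) algebra
  then show ?thesis by (simp add: power2_eq_iff_nonneg)
qed

lemma norm_reflect: "norm (reflect z) = norm z"
  by (simp add: reflect_def norm_eq inner_vec_def sum_2)

lemma linear_spiral: "linear (spiral u)"
  by (simp add: linear_iff spiral_def vec_eq_iff forall_2 algebra_simps)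

lemma linear_reflect: "linear reflect"
  by (simp add: linear_iff reflect_def vec_eq_iff forall_2 algebra_simps)

lemma dilation_linear:
  assumes "linear \<phi>" "r > 0" "\<And>x. norm (\<phi> x) = r * norm x"
  shows "dilation \<phi>"
  unfolding dilation_def dist_norm
  using assms(2) by (intro exI[of _ r]) (simp add: linear_diff[OF assms(1), symmetric] assms(3))

lemma dilation_spiral: "u \<noteq> 0 \<Longrightarrow> dilation (spiral u)"
  by (rule dilation_linear[OF linear_spiral, of "norm u"]) (simp_all add: norm_spiral)

lemma dilation_reflect: "dilation reflect"
  by (rule dilation_linear[OF linear_reflect, of 1]) (simp_all add: norm_reflect)

lemma dilation_translation: "dilation (\<lambda>x. x + b)"
  unfolding dilation_def by (intro exI[of _ 1]) simp

lemma det2_spiral: "det2 (spiral u v) (spiral u w) = (u \<bullet> u) * det2 v w"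
  by (simp add: det2_def spiral_def inner_vec_def sum_2 algebra_simps)

lemma det2_reflect: "det2 (reflect v) (reflect w) = - det2 v w"
  by (simp add: det2_def reflect_def)

lemma det2_nonzeroD: "det2 v w \<noteq> 0 \<Longrightarrow> v \<noteq> 0 \<and> w \<noteq> 0"
  by (auto simp: det2_def)

lemma spiral_e1: "spiral v e1 = v"
  by (simp add: spiral_def vec_eq_iff forall_2)

text \<open>This is the complex quotient \<open>w / v\<close>: the product of \<open>w\<close> with
  the conjugate of \<open>v\<close> has real part \<open>v \<bullet> w\<close> and imaginary part
  \<open>det2 v w\<close>.\<close>

lemma spiral_solve:
  assumes "v \<noteq> 0"
  shows "w = spiral v ((1 / (v \<bullet> v)) *\<^sub>R vector [v \<bullet> w, det2 v w])"
proof -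
  have "v \<bullet> v \<noteq> 0" using assms by simp
  then have "v$1 * v$1 + v$2 * v$2 \<noteq> 0"
    by (simp add: inner_vec_def sum_2)
  moreover have "v$1 * (v$1 * w$1 + v$2 * w$2) - v$2 * (v$1 * w$2 - w$1 * v$2) =
      w$1 * (v$1 * v$1 + v$2 * v$2)"
    "v$2 * (v$1 * w$1 + v$2 * w$2) + v$1 * (v$1 * w$2 - w$1 * v$2) =
      w$2 * (v$1 * v$1 + v$2 * v$2)"
    by (simp_all add: algebra_simps)
  ultimately show ?thesis
    by (simp add: spiral_def det2_def inner_vec_def sum_2 vec_eq_iff forall_2
        diff_divide_distrib[symmetric] add_divide_distrib[symmetric])
qed

section \<open>Classification of equivariant forms in one and two vectors\<close>

lemma equivariant_cubic_form:
  fixes K :: "real^2 \<Rightarrow> real^2"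
  assumes "\<And>u. u \<noteq> 0 \<Longrightarrow> K (spiral u e1) = (u \<bullet> u) *\<^sub>R spiral u (K e1)"
    and "K (reflect e1) = - reflect (K e1)"
  shows "\<exists>c. \<forall>v. v \<noteq> 0 \<longrightarrow> K v = (c * (v \<bullet> v)) *\<^sub>R rot90 v"
proof -
  \<comment> \<open>As \<open>reflect\<close> fixes \<open>e1\<close>, the value \<open>K e1\<close>
    is purely imaginary; \<open>spiral v e1 = v\<close> then carries it to every other
    \<open>v\<close>.\<close>
  have "K e1 $ 1 = 0"
    using assms(2) by (simp add: reflect_def vec_eq_iff forall_2)
  then have "K v = (K e1 $ 2 * (v \<bullet> v)) *\<^sub>R rot90 v" if "v \<noteq> 0" for v
    using assms(1)[OF that]
    by (simp add: spiral_e1) (simp add: spiral_def rot90_def vec_eq_iff forall_2)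
  then show ?thesis by blast
qed

text \<open>Writing \<open>w\<close> as the complex product of \<open>v\<close> and \<open>z\<close>
  reduces \<open>K v w\<close> to \<open>K e1 z\<close>, hence by linearity to
  \<open>K e1 e1\<close> and \<open>K e1 e2\<close>. The reflection makes the first imaginary and
  the second real.\<close>

lemma equivariant_quadratic_linear_form:
  fixes K :: "real^2 \<Rightarrow> real^2 \<Rightarrow> real^2"
  assumes lin: "\<And>v. linear (K v)"
    and spiral: "\<And>u v w. u \<noteq> 0 \<Longrightarrow> det2 v w \<noteq> 0 \<Longrightarrow>
      K (spiral u v) (spiral u w) = (u \<bullet> u) *\<^sub>R spiral u (K v w)"
    and reflect: "\<And>v w. det2 v w \<noteq> 0 \<Longrightarrow> K (reflect v) (reflect w) = - reflect (K v w)"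
  shows "\<exists>a b. \<forall>v w. det2 v w \<noteq> 0 \<longrightarrow> K v w = (a * (v \<bullet> w)) *\<^sub>R rot90 v + (b * det2 v w) *\<^sub>R v"
proof -
  have Ke1: "K e1 z = z$1 *\<^sub>R K e1 e1 + z$2 *\<^sub>R K e1 e2" for z
  proof -
    have "z = z$1 *\<^sub>R e1 + z$2 *\<^sub>R e2" by (simp add: vec_eq_iff forall_2)
    then have "K e1 z = K e1 (z$1 *\<^sub>R e1 + z$2 *\<^sub>R e2)" by simp
    then show ?thesis
      by (simp add: linear_add[OF lin] linear_scale[OF lin])
  qed
  have refl_e1: "reflect e1 = e1"
    by (simp add: reflect_def vec_eq_iff forall_2)
  have "K e1 (reflect z) = - reflect (K e1 z)" if "z$2 \<noteq> 0" for z
    using reflect[of e1 z] that by (simp add: det2_def refl_e1)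
  \<comment> \<open>Equivariance is available only for nondegenerate pairs, so information on
    \<open>K e1 e1\<close> is extracted from the pair \<open>e1, (1, 1)\<close>.\<close>
  from this[of e2] this[of "vector [1, 1]"]
  have 1: "K e1 e1 $ 1 = 0" "K e1 e2 $ 2 = 0"
    unfolding Ke1[of "reflect _"] Ke1[of "vector [1, 1]"]
    by (simp_all add: reflect_def vec_eq_iff forall_2)
  have "K v w = (K e1 e1 $ 2 * (v \<bullet> w)) *\<^sub>R rot90 v + (K e1 e2 $ 1 * det2 v w) *\<^sub>R v"
    if "det2 v w \<noteq> 0" for v w
  proof -
    define z :: "real^2" where "z = (1 / (v \<bullet> v)) *\<^sub>R vector [v \<bullet> w, det2 v w]"
    have v: "v \<noteq> 0" "v \<bullet> v \<noteq> 0" using det2_nonzeroD[OF that] by auto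
    have w: "w = spiral v z" unfolding z_def by (rule spiral_solve[OF v(1)])
    have z: "(v \<bullet> v) * z$1 = v \<bullet> w" "(v \<bullet> v) * z$2 = det2 v w"
      using v by (simp_all add: z_def)
    have "det2 e1 z \<noteq> 0"
      using z v that by (auto simp: det2_def)
    from spiral[OF v(1) this] have "K v w = (v \<bullet> v) *\<^sub>R spiral v (K e1 z)"
      by (simp add: spiral_e1 w[symmetric])
    then show ?thesis
      unfolding Ke1[of z] z[symmetric] using 1
      by (simp add: spiral_def rot90_def vec_eq_iff forall_2 algebra_simps)
  qed
  then show ?thesis by blast
qed

text \<open>Four values determine a cubic polynomial. They avoid \<open>t = 0\<close>, where the
  triangle \<open>0, v, t w\<close> degenerates.\<close>

lemma cubic_coeffs_eq:
  fixes a0 a1 a2 a3 b0 b1 b2 b3 :: "real^2"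
  assumes "\<And>t::real. t \<noteq> 0 \<Longrightarrow>
    a0 + t *\<^sub>R a1 + t^2 *\<^sub>R a2 + t^3 *\<^sub>R a3 = b0 + t *\<^sub>R b1 + t^2 *\<^sub>R b2 + t^3 *\<^sub>R b3"
  shows "a0 = b0 \<and> a1 = b1 \<and> a2 = b2 \<and> a3 = b3"
  using assms[of 1] assms[of "-1"] assms[of 2] assms[of "-2"]
  by (simp add: vec_eq_iff forall_2)

text \<open>The limit gives \<open>a = 0\<close>, after which a factor \<open>s\<close> cancels.
  Iterated, this compares Taylor coefficients when the remainder is known only through its
  limit.\<close>

lemma at_right_0_step:
  fixes h :: "real \<Rightarrow> 'a::real_normed_vector"
  assumes "\<forall>\<^sub>F s in at_right 0. a + s *\<^sub>R h s = 0" "(h \<longlongrightarrow> L) (at_right 0)"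
  shows "a = 0" "\<forall>\<^sub>F s in at_right 0. h s = 0"
proof -
  have "((\<lambda>s. a + s *\<^sub>R h s) \<longlongrightarrow> a + 0 *\<^sub>R L) (at_right 0)"
    by (intro tendsto_intros assms)
  moreover have "((\<lambda>s. a + s *\<^sub>R h s) \<longlongrightarrow> 0) (at_right 0)"
    using assms(1) by (rule tendsto_eventually)
  ultimately show "a = 0"
    using tendsto_unique[of "at_right (0::real)"] by fastforce
  with assms(1) have "\<forall>\<^sub>F s in at_right 0. s *\<^sub>R h s = 0" by simp
  then show "\<forall>\<^sub>F s in at_right 0. h s = 0"
    using eventually_at_right_less[of "0::real"] by eventually_elim auto
qed

section \<open>Moments of triangles\<close>

locale center =
  fixes C :: "(real^2) list \<Rightarrow> real^2"
  assumes cyclic: "\<And>P. signed_area P \<noteq> 0 \<Longrightarrow> C (rotate1 P) = C P"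
    and analytic: "\<And>P. signed_area P \<noteq> 0 \<Longrightarrow> real_analytic_at C P"
    and dilations: "\<And>\<phi> P. dilation \<phi> \<Longrightarrow> signed_area P \<noteq> 0 \<Longrightarrow> C (map \<phi> P) = \<phi> (C P)"
    and archimedes: "\<And>P k X Q R.
      0 < k \<Longrightarrow> k < length P \<Longrightarrow>
      Q = take (Suc k) P @ rev X \<Longrightarrow> R = P ! 0 # X @ drop k P \<Longrightarrow>
      signed_area P \<noteq> 0 \<Longrightarrow> signed_area Q \<noteq> 0 \<Longrightarrow> signed_area R \<noteq> 0 \<Longrightarrow>
      C P = (signed_area Q *\<^sub>R C Q + signed_area R *\<^sub>R C R) /\<^sub>R (signed_area Q + signed_area R)"
begin

text \<open>It vanishes on polygons of zero area whatever \<open>C\<close> is there, so equivariance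
  of \<open>tri\<close> can be stated for all pairs of vectors.\<close>

definition moment :: "(real^2) list \<Rightarrow> real^2" where
  "moment P = signed_area P *\<^sub>R C P"

definition tri :: "real^2 \<Rightarrow> real^2 \<Rightarrow> real^2" where
  "tri v w = moment [0, v, w]"

text \<open>The Archimedes Lemma with empty \<open>X\<close>: the cut is the diagonal from
  \<open>hd P\<close> to \<open>last P\<close>. Two vertices are needed for the index of
  \<open>last P\<close> to be positive.\<close>

lemma moment_snoc:
  assumes "length P \<ge> 2"
    and "signed_area P \<noteq> 0" "signed_area (P @ [x]) \<noteq> 0" "signed_area [hd P, last P, x] \<noteq> 0"
  shows "moment (P @ [x]) = moment P + moment [hd P, last P, x]"
proof -
  have P: "P \<noteq> []" using assms(1) by auto
  have *: "signed_area P + signed_area [hd P, last P, x] = signed_area (P @ [x])"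
    using signed_area_snoc[OF P] by simp
  have "drop (length P - 1) P = [last P]"
    using P by (metis append_butlast_last_id append_eq_conv_conj length_butlast)
  then have "C (P @ [x]) = (signed_area P *\<^sub>R C P + signed_area [hd P, last P, x] *\<^sub>R C [hd P, last P, x]) /\<^sub>R
      (signed_area P + signed_area [hd P, last P, x])"
    using assms P
    by (intro archimedes[of "length P - 1" _ _ "[]"]) (auto simp: nth_append hd_conv_nth)
  then show ?thesis
    using assms(3) unfolding * by (simp add: moment_def)
qed

text \<open>The area is multiplied by \<open>c\<close>, which is negative for a reflection, and the
  center is moved by \<open>g\<close>. For degenerate pairs both sides are 0.\<close>

lemma tri_linear_dilation:
  assumes "dilation g" "linear g" "\<And>v w. det2 (g v) (g w) = c * det2 v w"
  shows "tri (g v) (g w) = c *\<^sub>R g (tri v w)"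
proof (cases "det2 v w = 0")
  case False
  with dilations[OF assms(1), of "[0, v, w]"] have "C [0, g v, g w] = g (C [0, v, w])"
    by (simp add: signed_area_0 linear_0[OF assms(2)])
  then show ?thesis
    by (simp add: tri_def moment_def signed_area_0 assms(3) linear_scale[OF assms(2)])
qed (simp add: tri_def moment_def signed_area_0 assms linear_0)

lemma tri_spiral: "u \<noteq> 0 \<Longrightarrow> tri (spiral u v) (spiral u w) = (u \<bullet> u) *\<^sub>R spiral u (tri v w)"
  by (rule tri_linear_dilation) (simp_all add: dilation_spiral linear_spiral det2_spiral)

lemma tri_reflect: "tri (reflect v) (reflect w) = - reflect (tri v w)"
  using tri_linear_dilation[of reflect "-1"]
  by (simp add: dilation_reflect linear_reflect det2_reflect)

text \<open>Area contributes degree two and the center degree one; scaling is \<open>spiral\<close>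
  by a positive real number.\<close>

lemma tri_scaleR:
  assumes "s > 0"
  shows "tri (s *\<^sub>R v) (s *\<^sub>R w) = s^3 *\<^sub>R tri v w"
proof -
  have "spiral (s *\<^sub>R e1) z = s *\<^sub>R z" for z
    by (simp add: spiral_def vec_eq_iff forall_2)
  moreover have "(s *\<^sub>R e1) \<bullet> (s *\<^sub>R e1) = s^2"
    by (simp add: inner_vec_def sum_2 power2_eq_square)
  moreover have "s *\<^sub>R e1 \<noteq> 0"
    using assms by (simp add: vec_eq_iff forall_2)
  ultimately show ?thesis
    using tri_spiral[of "s *\<^sub>R e1" v w] by (simp add: power3_eq_cube power2_eq_square)
qed

text \<open>Translating by \<open>a\<close> shifts the center by \<open>a\<close>, and the moment
  weights this shift by the area.\<close>

lemma moment_triangle: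
  assumes "signed_area [a, b, c] \<noteq> 0"
  shows "moment [a, b, c] = tri (b - a) (c - a) + signed_area [a, b, c] *\<^sub>R a"
proof -
  have "signed_area [0, b - a, c - a] = signed_area [a, b, c]"
    by (simp add: signed_area_triangle)
  moreover from this have "C [a, b, c] = C [0, b - a, c - a] + a"
    using dilations[OF dilation_translation, of "[0, b - a, c - a]" a] assms by simp
  ultimately show ?thesis
    by (simp add: tri_def moment_def scaleR_add_right)
qed

section \<open>Triangle moments as cubic forms\<close>

lemma taylor_expansion_along:
  fixes d :: "'v::real_vector \<Rightarrow> nat \<Rightarrow> real^2"
  assumes "signed_area P \<noteq> 0" "\<And>i. linear (\<lambda>x. d x i)"
  shows "\<exists>p R. (\<forall>k. hpoly k (p k)) \<and> (\<forall>x. (R x \<longlongrightarrow> 0) (at_right 0)) \<and>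
    (\<forall>x s. s > 0 \<longrightarrow> C (map (\<lambda>i. P!i + s *\<^sub>R d x i) [0..<length P]) =
      p 0 x + s *\<^sub>R p 1 x + s^2 *\<^sub>R p 2 x + s^3 *\<^sub>R p 3 x + s^3 *\<^sub>R R x s)"
proof -
  obtain p where p: "\<And>k. hpoly k (p k)"
    "\<And>x. ((\<lambda>s. (C (map (\<lambda>i. P!i + s *\<^sub>R d x i) [0..<length P]) - (\<Sum>k<4. s^k *\<^sub>R p k x)) /\<^sub>R s^3)
      \<longlongrightarrow> 0) (at_right 0)"
    using taylor_expansion[of C P d, OF analytic[OF assms(1)] assms(2)] by blast
  define R where "R x s = (C (map (\<lambda>i. P!i + s *\<^sub>R d x i) [0..<length P]) - (\<Sum>k<4. s^k *\<^sub>R p k x)) /\<^sub>R s^3"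
    for x s
  have "C (map (\<lambda>i. P!i + s *\<^sub>R d x i) [0..<length P]) = (\<Sum>k<4. s^k *\<^sub>R p k x) + s^3 *\<^sub>R R x s"
    if "s > 0" for s x
    using that by (simp add: R_def)
  moreover have "(\<Sum>k<4. s^k *\<^sub>R p k x) = p 0 x + s *\<^sub>R p 1 x + s^2 *\<^sub>R p 2 x + s^3 *\<^sub>R p 3 x" for s x
    by (simp add: numeral_eq_Suc)
  moreover have "(R x \<longlongrightarrow> 0) (at_right 0)" for x
    using p(2)[of x] by (simp add: R_def[abs_def])
  ultimately show ?thesis
    using p(1) by (intro exI[of _ p] exI[of _ R]) simp
qed

text \<open>Nothing is assumed about analyticity at the degenerate triangle \<open>0, 0, 0\<close>,
  but \<open>[0, e1, e2, 0, 0]\<close> and \<open>[0, e1, e2, 0]\<close> have area 1/2, so the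
  expansion applies there. Homogeneity of \<open>tri\<close> then singles out the terms of order
  3.\<close>

lemma tri_trilinear:
  obtains T where "\<And>x y. linear (T x y)" "\<And>x z. linear (\<lambda>y. T x y z)" "\<And>y z. linear (\<lambda>x. T x y z)"
    "\<And>v w. det2 v w \<noteq> 0 \<Longrightarrow> tri v w = T (v, w) (v, w) (v, w)"
proof -
  \<comment> \<open>Only the copies of \<open>0\<close> at positions 3 and 4 move. The quadrilateral
    has no position 4, so it sees \<open>v\<close> alone.\<close>
  define d :: "(real^2) \<times> (real^2) \<Rightarrow> nat \<Rightarrow> real^2" where
    "d x i = (if i = 3 then fst x else if i = 4 then snd x else 0)" for x i
  have lin: "linear (\<lambda>x. d x i)" for i
    by (auto simp: d_def linear_iff)
  have area5: "signed_area [0, e1, e2, v, w] = (1 - v$1 + det2 v w) / 2" for v w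
    by (simp add: signed_area_edge_sum edge_sum_pentagon det2_def)
  have area4: "signed_area [0, e1, e2, v] = (1 - v$1) / 2" for v
    by (simp add: signed_area_edge_sum edge_sum_quad det2_def)
  have nz5: "signed_area [0, e1, e2, 0, 0] \<noteq> 0" and nz4: "signed_area [0, e1, e2, 0] \<noteq> 0"
    by (simp_all add: area5 area4 det2_def)
  obtain p R where p: "\<And>k. hpoly k (p k)" "\<And>x. (R x \<longlongrightarrow> 0) (at_right 0)"
    and C5: "\<And>x s. s > 0 \<Longrightarrow> C (map (\<lambda>i. [0, e1, e2, 0, 0]!i + s *\<^sub>R d x i) [0..<length [0, e1, e2, 0, 0]]) =
      p 0 x + s *\<^sub>R p 1 x + s^2 *\<^sub>R p 2 x + s^3 *\<^sub>R p 3 x + s^3 *\<^sub>R R x s"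
    using taylor_expansion_along[of _ d, OF nz5 lin] by blast
  obtain q S where q: "\<And>k. hpoly k (q k)" "\<And>x. (S x \<longlongrightarrow> 0) (at_right 0)"
    and C4: "\<And>x s. s > 0 \<Longrightarrow> C (map (\<lambda>i. [0, e1, e2, 0]!i + s *\<^sub>R d x i) [0..<length [0, e1, e2, 0]]) =
      q 0 x + s *\<^sub>R q 1 x + s^2 *\<^sub>R q 2 x + s^3 *\<^sub>R q 3 x + s^3 *\<^sub>R S x s"
    using taylor_expansion_along[of _ d, OF nz4 lin] by blast
  have e: "map (\<lambda>i. [0, e1, e2, 0, 0]!i + s *\<^sub>R d x i) [0..<length [0, e1, e2, 0, 0]] =
      [0, e1, e2, s *\<^sub>R fst x, s *\<^sub>R snd x]"
    "map (\<lambda>i. [0, e1, e2, 0]!i + s *\<^sub>R d x i) [0..<length [0, e1, e2, 0]] = [0, e1, e2, s *\<^sub>R fst x]" for s x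
    by (simp_all add: d_def upt_rec)
  note C5 = C5[unfolded e] and C4 = C4[unfolded e]
  \<comment> \<open>The coefficient of \<open>s^3\<close> in the moment of the pentagon minus that
    of the quadrilateral, from the expansions of \<open>C\<close> and the explicit areas. The
    determinant is expanded into products of coordinates to make homogeneity visible.\<close>
  define H where "H x = (1/2) *\<^sub>R (p 3 x - q 3 x - (fst x$1 *\<^sub>R (p 2 x - q 2 x)) +
    (fst x$1 *\<^sub>R snd x$2 *\<^sub>R p 1 x - snd x$1 *\<^sub>R fst x$2 *\<^sub>R p 1 x))" for x
  have lin_comp: "linear (\<lambda>x::(real^2) \<times> (real^2). fst x$i)" "linear (\<lambda>x::(real^2) \<times> (real^2). snd x$i)" for i
    by (simp_all add: linear_iff)
  have hpoly2: "hpoly 3 (\<lambda>x. l x *\<^sub>R f x)" if "linear l" "hpoly 2 f"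
    for l :: "(real^2) \<times> (real^2) \<Rightarrow> real" and f :: "(real^2) \<times> (real^2) \<Rightarrow> real^2"
    using hpoly.mult[OF that] by (simp add: eval_nat_numeral)
  have hpoly1: "hpoly 2 (\<lambda>x. l x *\<^sub>R f x)" if "linear l" "hpoly 1 f"
    for l :: "(real^2) \<times> (real^2) \<Rightarrow> real" and f :: "(real^2) \<times> (real^2) \<Rightarrow> real^2"
    using hpoly.mult[OF that] by (simp add: eval_nat_numeral)
  have "hpoly 3 H"
    unfolding H_def
    by (intro hpoly_scaleR hpoly.add hpoly_diff hpoly2 hpoly1 lin_comp p(1) q(1))
  then obtain T where T: "\<And>x y. linear (T x y)" "\<And>x z. linear (\<lambda>y. T x y z)" "\<And>y z. linear (\<lambda>x. T x y z)"
    "\<And>x. H x = T x x x"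
    using hpoly_3_trilinear[of 3 H] by blast
  have "tri v w = H (v, w)" if vw: "det2 v w \<noteq> 0" for v w
  proof -
    define x where "x = (v, w)"
    define A5 where "A5 s = signed_area [0, e1, e2, s *\<^sub>R v, s *\<^sub>R w]" for s
    define A4 where "A4 s = signed_area [0, e1, e2, s *\<^sub>R v]" for s
    have A5: "A5 = (\<lambda>s. (1 - s * v$1 + s^2 * det2 v w) / 2)"
      by (rule ext) (simp add: A5_def area5 det2_def power2_eq_square algebra_simps)
    have A4: "A4 = (\<lambda>s. (1 - s * v$1) / 2)"
      by (rule ext) (simp add: A4_def area4)
    have lim5: "(A5 \<longlongrightarrow> (1 - 0 * v$1 + 0^2 * det2 v w) / 2) (at_right 0)"
      unfolding A5 by (intro tendsto_intros) auto
    have lim4: "(A4 \<longlongrightarrow> (1 - 0 * v$1) / 2) (at_right 0)"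
      unfolding A4 by (intro tendsto_intros) auto
    have ne5: "\<forall>\<^sub>F s in at_right 0. A5 s \<noteq> 0" and ne4: "\<forall>\<^sub>F s in at_right 0. A4 s \<noteq> 0"
      by (rule tendsto_imp_eventually_ne[OF lim5] tendsto_imp_eventually_ne[OF lim4], simp)+
    \<comment> \<open>\<open>Y\<close> and \<open>Z\<close> are the coefficients of orders 4 and 5,
      and \<open>b0\<close>, \<open>b1\<close>, \<open>b2\<close> those of orders 0 to 2;
      \<open>h\<close> collects everything of order 3 and above, divided by \<open>s^3\<close>, less
      \<open>tri v w\<close>.\<close>
    define Y where "Y = (1/2) *\<^sub>R (det2 v w *\<^sub>R p 2 x - v$1 *\<^sub>R (p 3 x - q 3 x))"
    define Z where "Z = (1/2) *\<^sub>R det2 v w *\<^sub>R p 3 x"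
    define h where "h s = H x - tri v w + (s *\<^sub>R Y + s^2 *\<^sub>R Z + A5 s *\<^sub>R R x s - A4 s *\<^sub>R S x s)" for s
    define b0 where "b0 = (1/2) *\<^sub>R (p 0 x - q 0 x)"
    define b1 where "b1 = (1/2) *\<^sub>R (p 1 x - q 1 x - v$1 *\<^sub>R (p 0 x - q 0 x))"
    define b2 where "b2 = (1/2) *\<^sub>R (p 2 x - q 2 x - v$1 *\<^sub>R (p 1 x - q 1 x) + det2 v w *\<^sub>R p 0 x)"
    have "(h \<longlongrightarrow> H x - tri v w +
        (0 *\<^sub>R Y + 0^2 *\<^sub>R Z + ((1 - 0 * v$1 + 0^2 * det2 v w) / 2) *\<^sub>R 0 - ((1 - 0 * v$1) / 2) *\<^sub>R 0)) (at_right 0)"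
      unfolding h_def by (intro tendsto_intros lim5 lim4 p(2) q(2))
    then have limh: "(h \<longlongrightarrow> H x - tri v w) (at_right 0)" by simp
    have ev: "\<forall>\<^sub>F s in at_right 0. b0 + s *\<^sub>R (b1 + s *\<^sub>R (b2 + s *\<^sub>R h s)) = 0"
      using ne5 ne4 eventually_at_right_less[of "0::real"]
    proof eventually_elim
      case (elim s)
      have "moment ([0, e1, e2, s *\<^sub>R v] @ [s *\<^sub>R w]) = moment [0, e1, e2, s *\<^sub>R v] + moment [0, s *\<^sub>R v, s *\<^sub>R w]"
        using elim vw
        by (subst moment_snoc) (simp_all add: A5_def A4_def signed_area_0 det2_def)
      then have "A5 s *\<^sub>R (p 0 x + s *\<^sub>R p 1 x + s^2 *\<^sub>R p 2 x + s^3 *\<^sub>R p 3 x + s^3 *\<^sub>R R x s) =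
          A4 s *\<^sub>R (q 0 x + s *\<^sub>R q 1 x + s^2 *\<^sub>R q 2 x + s^3 *\<^sub>R q 3 x + s^3 *\<^sub>R S x s) + s^3 *\<^sub>R tri v w"
        using C5[OF elim(3), of x] C4[OF elim(3), of x] tri_scaleR[OF elim(3), of v w]
        by (simp add: moment_def[of "_ # e1 # _"] tri_def A5_def A4_def x_def)
      note eq = this[unfolded A5 A4]
      show ?case
        unfolding vec_eq_iff
      proof
        fix i
        have "(1 - s * v$1 + s^2 * det2 v w) *
            (p 0 x$i + s * p 1 x$i + s^2 * p 2 x$i + s^3 * p 3 x$i + s^3 * R x s$i) =
          (1 - s * v$1) * (q 0 x$i + s * q 1 x$i + s^2 * q 2 x$i + s^3 * q 3 x$i + s^3 * S x s$i) +
          2 * s^3 * tri v w$i"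
          using arg_cong[OF eq, of "\<lambda>z. 2 * z$i"] by simp
        moreover have "b0$i = (p 0 x$i - q 0 x$i) / 2"
          "b1$i = (p 1 x$i - q 1 x$i - v$1 * (p 0 x$i - q 0 x$i)) / 2"
          "b2$i = (p 2 x$i - q 2 x$i - v$1 * (p 1 x$i - q 1 x$i) + det2 v w * p 0 x$i) / 2"
          "H x$i = (p 3 x$i - q 3 x$i - v$1 * (p 2 x$i - q 2 x$i) + det2 v w * p 1 x$i) / 2"
          "h s$i = H x$i - tri v w$i + (s * (det2 v w * p 2 x$i - v$1 * (p 3 x$i - q 3 x$i)) / 2 +
            s^2 * (det2 v w * p 3 x$i) / 2 + (1 - s * v$1 + s^2 * det2 v w) / 2 * R x s$i -
            (1 - s * v$1) / 2 * S x s$i)"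
          unfolding b0_def b1_def b2_def H_def h_def Y_def Z_def A5 A4 x_def
          by (simp_all add: det2_def field_simps)
        ultimately have "2 * (b0$i + s * (b1$i + s * (b2$i + s * h s$i))) = 0"
          by algebra
        then show "(b0 + s *\<^sub>R (b1 + s *\<^sub>R (b2 + s *\<^sub>R h s)))$i = 0$i"
          by simp
      qed
    qed
    have "((\<lambda>s. b2 + s *\<^sub>R h s) \<longlongrightarrow> b2 + 0 *\<^sub>R (H x - tri v w)) (at_right 0)"
      by (intro tendsto_intros limh)
    note lim2 = this
    have "((\<lambda>s. b1 + s *\<^sub>R (b2 + s *\<^sub>R h s)) \<longlongrightarrow> b1 + 0 *\<^sub>R (b2 + 0 *\<^sub>R (H x - tri v w))) (at_right 0)"
      by (intro tendsto_intros lim2)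
    \<comment> \<open>Three divisions by \<open>s\<close> remove the orders 0, 1 and 2 and leave
      \<open>h s = 0\<close> near 0, while \<open>h\<close> tends to
      \<open>H x - tri v w\<close>.\<close>
    from at_right_0_step(2)[OF ev this]
    have "\<forall>\<^sub>F s in at_right 0. b2 + s *\<^sub>R h s = 0"
      by (rule at_right_0_step(2)[OF _ lim2])
    then have "\<forall>\<^sub>F s in at_right 0. h s = 0"
      by (rule at_right_0_step(2)[OF _ limh])
    then have "H x - tri v w = 0"
      using tendsto_unique[OF _ limh tendsto_eventually] by simp
    then show ?thesis by (simp add: x_def)
  qed
  with T show thesis by (intro that[of T]) simp_all
qed

text \<open>Multilinear expansion of \<open>T\<close> at \<open>(v, 0) + t (0, w)\<close>; the
  digits in the names are the degrees in \<open>v\<close> and \<open>w\<close>. Linearity is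
  recorded where the degree is one, as the classification of equivariant forms requires.\<close>

lemma tri_bihomogeneous:
  obtains f30 f21 f12 f03 where "\<And>v. linear (f21 v)" "\<And>w. linear (\<lambda>v. f12 v w)"
    "\<And>v w t. det2 v w \<noteq> 0 \<Longrightarrow> t \<noteq> 0 \<Longrightarrow>
      tri v (t *\<^sub>R w) = f30 v + t *\<^sub>R f21 v w + t^2 *\<^sub>R f12 v w + t^3 *\<^sub>R f03 w"
proof -
  obtain T where T: "\<And>x y. linear (T x y)" "\<And>x z. linear (\<lambda>y. T x y z)" "\<And>y z. linear (\<lambda>x. T x y z)"
    and tri: "\<And>v w. det2 v w \<noteq> 0 \<Longrightarrow> tri v w = T (v, w) (v, w) (v, w)"
    by (rule tri_trilinear) blast
  define L where "L v = (v, 0::real^2)" for v :: "real^2"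
  define R where "R w = (0::real^2, w)" for w :: "real^2"
  have linL: "linear L" and linR: "linear R"
    by (simp_all add: L_def R_def linear_iff)
  have comp: "linear (\<lambda>x. T y z (R x))" "linear (\<lambda>x. T y (R x) z)" "linear (\<lambda>x. T (R x) y z)"
    "linear (\<lambda>x. T y z (L x))" "linear (\<lambda>x. T y (L x) z)" "linear (\<lambda>x. T (L x) y z)" for y z
    using linear_compose[OF linR T(1)[of y z]] linear_compose[OF linR T(2)[of y z]]
      linear_compose[OF linR T(3)[of y z]] linear_compose[OF linL T(1)[of y z]]
      linear_compose[OF linL T(2)[of y z]] linear_compose[OF linL T(3)[of y z]]
    by (simp_all add: o_def)
  show thesis
  proof (rule that)
    show "linear (\<lambda>w. T (L v) (L v) (R w) + T (L v) (R w) (L v) + T (R w) (L v) (L v))" for v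
      by (intro linear_compose_add comp)
    show "linear (\<lambda>v. T (L v) (R w) (R w) + T (R w) (L v) (R w) + T (R w) (R w) (L v))" for w
      by (intro linear_compose_add comp)
    fix v w and t :: real
    assume "det2 v w \<noteq> 0" "t \<noteq> 0"
    then have nz: "det2 v (t *\<^sub>R w) \<noteq> 0"
      by (simp add: det2_def mult.assoc mult.left_commute right_diff_distrib[symmetric])
    have eq: "(v, t *\<^sub>R w) = L v + t *\<^sub>R R w" by (simp add: L_def R_def)
    show "tri v (t *\<^sub>R w) = T (L v) (L v) (L v) +
        t *\<^sub>R (T (L v) (L v) (R w) + T (L v) (R w) (L v) + T (R w) (L v) (L v)) +
        t^2 *\<^sub>R (T (L v) (R w) (R w) + T (R w) (L v) (R w) + T (R w) (R w) (L v)) +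
        t^3 *\<^sub>R T (R w) (R w) (R w)"
      unfolding tri[OF nz] eq
      by (simp only: linear_add[OF T(1)] linear_add[OF T(2)] linear_add[OF T(3)]
          linear_scale[OF T(1)] linear_scale[OF T(2)] linear_scale[OF T(3)])
        (simp add: power2_eq_square power3_eq_cube algebra_simps)
  qed
qed

end

section \<open>From triangles to polygons\<close>

text \<open>The area is a quadratic form in the vertices. A list \<open>js\<close> of indices covers
  the full polygon, the truncated polygon and the cut-off triangle at once.\<close>

lemma signed_area_perturb:
  "\<exists>B. \<forall>s. signed_area (map (\<lambda>i. u i + s *\<^sub>R d i) js) =
    signed_area (map u js) + s * B + s\<^sup>2 * signed_area (map d js)"
proof (intro exI allI)
  fix s
  let ?a = "\<lambda>i. js!i" and ?b = "\<lambda>i. js!(Suc i mod length js)"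
  have e: "edge_sum det2 (map f js) = (\<Sum>i<length js. det2 (f (?a i)) (f (?b i)))" for f
    unfolding edge_sum_def length_map
  proof (rule sum.cong[OF refl])
    fix i assume "i \<in> {..<length js}"
    then have "i < length js" "Suc i mod length js < length js"
      by (auto intro: mod_less_divisor)
    then show "det2 (map f js!i) (map f js!(Suc i mod length js)) = det2 (f (?a i)) (f (?b i))"
      by simp
  qed
  have "det2 (u i + s *\<^sub>R d i) (u j + s *\<^sub>R d j) =
      det2 (u i) (u j) + s * (det2 (u i) (d j) + det2 (d i) (u j)) + s\<^sup>2 * det2 (d i) (d j)" for i j
    by (simp add: det2_def algebra_simps power2_eq_square)
  then show "signed_area (map (\<lambda>i. u i + s *\<^sub>R d i) js) = signed_area (map u js) +
      s * ((\<Sum>i<length js. det2 (u (?a i)) (d (?b i)) + det2 (d (?a i)) (u (?b i))) / 2) +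
      s\<^sup>2 * signed_area (map d js)"
    unfolding signed_area_edge_sum e
    by (simp add: sum.distrib sum_distrib_left[symmetric] add_divide_distrib)
qed

text \<open>Near 0 the lowest nonvanishing coefficient decides, and there is one because
  \<open>c\<close> is nonzero.\<close>

lemma eventually_quadratic_nonzero:
  fixes a b c :: real
  assumes "c \<noteq> 0"
  shows "\<forall>\<^sub>F s in at_right 0. a + s * b + s\<^sup>2 * c \<noteq> 0"
proof (cases "a = 0")
  case False
  have "((\<lambda>s. a + s * b + s\<^sup>2 * c) \<longlongrightarrow> a + 0 * b + 0\<^sup>2 * c) (at_right 0)"
    by (intro tendsto_intros)
  then show ?thesis
    by (rule tendsto_imp_eventually_ne) (use False in simp)
next
  case True
  have "\<forall>\<^sub>F s in at_right 0. b + s * c \<noteq> 0"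
  proof (cases "b = 0")
    case False
    have "((\<lambda>s. b + s * c) \<longlongrightarrow> b + 0 * c) (at_right 0)"
      by (intro tendsto_intros)
    then show ?thesis
      by (rule tendsto_imp_eventually_ne) (use False in simp)
  next
    case True
    show ?thesis
      using eventually_at_right_less[of "0::real"] by eventually_elim (use True assms in simp)
  qed
  with eventually_at_right_less[of "0::real"] show ?thesis
  proof eventually_elim
    case (elim s)
    have "a + s * b + s\<^sup>2 * c = s * (b + s * c)"
      using True by (simp add: algebra_simps power2_eq_square)
    with elim show ?case by simp
  qed
qed

lemma tendsto_euler_edge:
  assumes "(f \<longlongrightarrow> a) F" "(g \<longlongrightarrow> b) F"
  shows "((\<lambda>x. euler_edge t (f x) (g x)) \<longlongrightarrow> euler_edge t a b) F"
proof -
  have ccm: "ccm_edge V W = (1/4) *\<^sub>R ((V \<bullet> V) *\<^sub>R (W$2 *\<^sub>R e1 - W$1 *\<^sub>R e2) -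
      (W \<bullet> W) *\<^sub>R (V$2 *\<^sub>R e1 - V$1 *\<^sub>R e2))" for V W
    by (simp add: ccm_edge_def vec_eq_iff forall_2)
  show ?thesis
    unfolding euler_edge_def ccm det2_def by (intro tendsto_intros assms) simp_all
qed

context center
begin

section \<open>The six coefficients of a triangle moment\<close>

lemma tri_formula:
  obtains a b a' b' c c' where "\<And>v w. det2 v w \<noteq> 0 \<Longrightarrow>
    tri v w = (c * (v \<bullet> v)) *\<^sub>R rot90 v + ((a * (v \<bullet> w)) *\<^sub>R rot90 v + (b * det2 v w) *\<^sub>R v) +
      ((a' * (w \<bullet> v)) *\<^sub>R rot90 w + (b' * det2 w v) *\<^sub>R w) + (c' * (w \<bullet> w)) *\<^sub>R rot90 w"
proof -
  obtain f30 f21 f12 f03 where lin: "\<And>v. linear (f21 v)" "\<And>w. linear (\<lambda>v. f12 v w)"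
    and tri: "\<And>v w t. det2 v w \<noteq> 0 \<Longrightarrow> t \<noteq> 0 \<Longrightarrow>
      tri v (t *\<^sub>R w) = f30 v + t *\<^sub>R f21 v w + t^2 *\<^sub>R f12 v w + t^3 *\<^sub>R f03 w"
    by (rule tri_bihomogeneous) blast
  \<comment> \<open>Equivariance of \<open>tri\<close> at \<open>(v, t w)\<close> is expanded in
    powers of \<open>t\<close>; comparing coefficients transfers it to each bihomogeneous
    part.\<close>
  have equiv: "f30 (g v) = c *\<^sub>R g (f30 v) \<and> f21 (g v) (g w) = c *\<^sub>R g (f21 v w) \<and>
      f12 (g v) (g w) = c *\<^sub>R g (f12 v w) \<and> f03 (g w) = c *\<^sub>R g (f03 w)"
    if g: "linear g" "c \<noteq> 0" "\<And>v w. det2 (g v) (g w) = c * det2 v w"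
      and t: "\<And>v w. tri (g v) (g w) = c *\<^sub>R g (tri v w)" and vw: "det2 v w \<noteq> 0" for g c v w
  proof (rule cubic_coeffs_eq)
    fix t :: real assume "t \<noteq> 0"
    have "det2 (g v) (g w) \<noteq> 0" using g vw by simp
    from tri[OF this \<open>t \<noteq> 0\<close>] t[of v "t *\<^sub>R w"] tri[OF vw \<open>t \<noteq> 0\<close>]
    show "f30 (g v) + t *\<^sub>R f21 (g v) (g w) + t\<^sup>2 *\<^sub>R f12 (g v) (g w) + t ^ 3 *\<^sub>R f03 (g w) =
        c *\<^sub>R g (f30 v) + t *\<^sub>R (c *\<^sub>R g (f21 v w)) + t\<^sup>2 *\<^sub>R (c *\<^sub>R g (f12 v w)) + t ^ 3 *\<^sub>R (c *\<^sub>R g (f03 w))"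
      by (simp add: linear_scale[OF g(1)] linear_add[OF g(1)] scaleR_add_right mult.commute)
  qed
  have sp: "f30 (spiral u v) = (u \<bullet> u) *\<^sub>R spiral u (f30 v)"
    "f21 (spiral u v) (spiral u w) = (u \<bullet> u) *\<^sub>R spiral u (f21 v w)"
    "f12 (spiral u v) (spiral u w) = (u \<bullet> u) *\<^sub>R spiral u (f12 v w)"
    "f03 (spiral u w) = (u \<bullet> u) *\<^sub>R spiral u (f03 w)"
    if "u \<noteq> 0" "det2 v w \<noteq> 0" for u v w
    using equiv[of "spiral u" "u \<bullet> u" v w] that by (simp_all add: linear_spiral det2_spiral tri_spiral)
  have re: "f30 (reflect v) = - reflect (f30 v)"
    "f21 (reflect v) (reflect w) = - reflect (f21 v w)"
    "f12 (reflect v) (reflect w) = - reflect (f12 v w)"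
    "f03 (reflect w) = - reflect (f03 w)"
    if "det2 v w \<noteq> 0" for v w
    using equiv[of reflect "-1" v w] that by (simp_all add: linear_reflect det2_reflect tri_reflect)
  have swap: "det2 w v \<noteq> 0 \<longleftrightarrow> det2 v w \<noteq> 0" for v w
    by (auto simp: det2_def)
  \<comment> \<open>\<open>f30\<close> and \<open>f03\<close> depend on one vector, but equivariance
    was obtained for nondegenerate pairs; \<open>e2\<close> serves as the companion of
    \<open>e1\<close>.\<close>
  have e12: "det2 e1 e2 \<noteq> 0" by (simp add: det2_def)
  obtain c where c: "\<And>v. v \<noteq> 0 \<Longrightarrow> f30 v = (c * (v \<bullet> v)) *\<^sub>R rot90 v"
    using equivariant_cubic_form[of f30] sp(1)[OF _ e12] re(1)[OF e12] by blast
  obtain c' where c': "\<And>v. v \<noteq> 0 \<Longrightarrow> f03 v = (c' * (v \<bullet> v)) *\<^sub>R rot90 v"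
    using equivariant_cubic_form[of f03] sp(4)[OF _ swap[THEN iffD2, OF e12]] re(4)[OF swap[THEN iffD2, OF e12]]
    by blast
  obtain a b where ab: "\<And>v w. det2 v w \<noteq> 0 \<Longrightarrow>
      f21 v w = (a * (v \<bullet> w)) *\<^sub>R rot90 v + (b * det2 v w) *\<^sub>R v"
    using equivariant_quadratic_linear_form[of f21] lin(1) sp(2) re(2) by blast
  \<comment> \<open>The linear argument of \<open>f12\<close> is its first one, so the roles of
    \<open>v\<close> and \<open>w\<close> are exchanged.\<close>
  obtain a' b' where ab': "\<And>v w. det2 w v \<noteq> 0 \<Longrightarrow>
      f12 v w = (a' * (w \<bullet> v)) *\<^sub>R rot90 w + (b' * det2 w v) *\<^sub>R w"
    using equivariant_quadratic_linear_form[of "\<lambda>w v. f12 v w"] lin(2) sp(3) re(3) swap by blast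
  show thesis
  proof (rule that)
    fix v w assume vw: "det2 v w \<noteq> 0"
    then have "v \<noteq> 0" "w \<noteq> 0" "det2 w v \<noteq> 0"
      using det2_nonzeroD swap by blast+
    then show "tri v w = (c * (v \<bullet> v)) *\<^sub>R rot90 v + ((a * (v \<bullet> w)) *\<^sub>R rot90 v + (b * det2 v w) *\<^sub>R v) +
      ((a' * (w \<bullet> v)) *\<^sub>R rot90 w + (b' * det2 w v) *\<^sub>R w) + (c' * (w \<bullet> w)) *\<^sub>R rot90 w"
      using tri[OF vw, of 1] by (simp add: c c' ab[OF vw] ab')
  qed
qed

section \<open>Linear relations between the six coefficients\<close>

lemma moment_rotate_triangle:
  "signed_area [a, b, c] \<noteq> 0 \<Longrightarrow> moment [b, c, a] = moment [a, b, c]"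
  using cyclic[of "[a, b, c]"]
  by (simp add: moment_def signed_area_edge_sum edge_sum_triangle add_ac)

text \<open>Read from its vertex \<open>v\<close>, the same triangle has edge vectors
  \<open>w - v\<close> and \<open>- v\<close>; moving \<open>v\<close> to the origin costs the area
  times \<open>v\<close>.\<close>

lemma tri_cyclic:
  assumes "det2 v w \<noteq> 0"
  shows "tri v w = tri (w - v) (- v) + (det2 v w / 2) *\<^sub>R v"
proof -
  have "signed_area [v, w, 0] = det2 v w / 2"
    by (simp add: signed_area_edge_sum edge_sum_triangle det2_def)
  with moment_triangle[of v w 0] moment_rotate_triangle[of 0 v w] assms show ?thesis
    by (simp add: tri_def signed_area_0)
qed

text \<open>The quadrilateral \<open>0, e1, (1, 1), (0, 2)\<close> is cut along both diagonals; the
  triangle \<open>e1, (1, 1), (0, 2)\<close> has area 1/2 and is moved to the origin. Cyclic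
  invariance alone leaves \<open>c\<close> and \<open>a'\<close> free in the formula for
  \<open>tri\<close>; this relation forces \<open>c = 0\<close>.\<close>

lemma moment_quad_diagonals:
  "tri e1 (vector [1, 1]) + tri (vector [1, 1]) (vector [0, 2]) =
    tri e2 (vector [-1, 2]) + (1/2) *\<^sub>R e1 + tri e1 (vector [0, 2])"
proof -
  let ?q = "vector [1, 1] :: real^2" and ?r = "vector [0, 2] :: real^2"
  note area = signed_area_edge_sum edge_sum_triangle edge_sum_quad det2_def
  have "moment ([0, e1, ?q] @ [?r]) = moment [0, e1, ?q] + moment [0, ?q, ?r]"
    by (subst moment_snoc) (simp_all add: area)
  moreover have "moment ([e1, ?q, ?r] @ [0]) = moment [e1, ?q, ?r] + moment [e1, ?r, 0]"
    by (subst moment_snoc) (simp_all add: area)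
  moreover have "moment [e1, ?q, ?r, 0] = moment [0, e1, ?q, ?r]"
    using cyclic[of "[0, e1, ?q, ?r]"] by (simp add: moment_def area)
  moreover have "moment [e1, ?r, 0] = moment [0, e1, ?r]"
    by (rule moment_rotate_triangle) (simp add: area)
  moreover have "moment [e1, ?q, ?r] = tri e2 (vector [-1, 2]) + (1/2) *\<^sub>R e1"
  proof -
    have "?q - e1 = e2" "?r - e1 = vector [-1, 2]" "signed_area [e1, ?q, ?r] = 1/2"
      by (simp_all add: vec_eq_iff forall_2 area)
    then show ?thesis using moment_triangle[of e1 ?q ?r] by simp
  qed
  ultimately show ?thesis by (simp add: tri_def)
qed

lemma moment_triangle_euler:
  obtains t where "\<And>a b c. signed_area [a, b, c] \<noteq> 0 \<Longrightarrow>
    moment [a, b, c] = edge_sum (euler_edge t) [a, b, c]"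
proof -
  obtain a b a' b' c c' where tri: "\<And>v w. det2 v w \<noteq> 0 \<Longrightarrow>
    tri v w = (c * (v \<bullet> v)) *\<^sub>R rot90 v + ((a * (v \<bullet> w)) *\<^sub>R rot90 v + (b * det2 v w) *\<^sub>R v) +
      ((a' * (w \<bullet> v)) *\<^sub>R rot90 w + (b' * det2 w v) *\<^sub>R w) + (c' * (w \<bullet> w)) *\<^sub>R rot90 w"
    by (rule tri_formula) (rule that, simp only: simp_thms)
  have nz: "det2 v w \<noteq> 0 \<Longrightarrow> det2 (w - v) (- v) \<noteq> 0" for v w
    by (simp add: det2_def algebra_simps)
  note ev = det2_def rot90_def inner_vec_def sum_2 vec_eq_iff forall_2
  have cyc: "tri e1 (vector [x, 1]) = tri (vector [x, 1] - e1) (- e1) + (1/2) *\<^sub>R e1" for x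
    using tri_cyclic[of e1 "vector [x, 1]"] by (simp add: det2_def)
  have "tri e1 (vector [x, 1]) = tri (vector [x - 1, 1]) (vector [-1, 0]) + (1/2) *\<^sub>R e1" for x
  proof -
    have "vector [x, 1] - e1 = (vector [x - 1, 1] :: real^2)" "- e1 = vector [-1, 0]"
      by (simp_all add: vec_eq_iff forall_2)
    with cyc[of x] show ?thesis by simp
  qed
  \<comment> \<open>Both sides are polynomials of degree at most 3 in \<open>x\<close>, so four
    values of \<open>x\<close> carry the whole identity.\<close>
  from this[of 0] this[of 1] this[of "-1"] this[of 2] moment_quad_diagonals
  have sol: "c = 0" "c' = 0" "a = - a'" "b' = - b" "b = 1/6 + a'/3"
    by (simp_all add: tri ev)
  \<comment> \<open>\<open>a' = 0\<close> gives \<open>(det2 v w / 6) *\<^sub>R (v + w)\<close>, the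
    moment of the centroid, and \<open>a' = 1/4\<close> that of the circumcenter.\<close>
  define t where "t = 1 - 4 * a'"
  show thesis
  proof (rule that[of t])
    fix P Q R assume nz: "signed_area [P, Q, R] \<noteq> 0"
    have "det2 (Q - P) (R - P) = 2 * signed_area [P, Q, R]"
      by (simp add: det2_def signed_area_triangle)
    with nz show "moment [P, Q, R] = edge_sum (euler_edge t) [P, Q, R]"
      unfolding moment_triangle[OF nz] edge_sum_triangle
      by (subst tri, simp,
          simp add: sol signed_area_triangle euler_edge_def ccm_edge_def t_def ev, simp add: field_simps)
  qed
qed

section \<open>Passage to the limit along a perturbation\<close>

lemma tendsto_center_along:
  assumes "signed_area P \<noteq> 0"
  shows "((\<lambda>s. C (map (\<lambda>i. P!i + s *\<^sub>R d i) [0..<length P])) \<longlongrightarrow> C P) (at_right 0)"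
proof -
  have lin: "linear (\<lambda>x::real. x *\<^sub>R d i)" for i
    by (simp add: linear_iff scaleR_add_left)
  obtain p R where p: "\<And>k. hpoly k (p k)" "\<And>x. (R x \<longlongrightarrow> 0) (at_right 0)"
    and C: "\<And>x s. s > 0 \<Longrightarrow> C (map (\<lambda>i. P!i + s *\<^sub>R (x *\<^sub>R d i)) [0..<length P]) =
      p 0 x + s *\<^sub>R p 1 x + s^2 *\<^sub>R p 2 x + s^3 *\<^sub>R p 3 x + s^3 *\<^sub>R R x s"
    using taylor_expansion_along[of P "\<lambda>x i. x *\<^sub>R d i", OF assms lin] by blast
  have lim: "((\<lambda>s. C (map (\<lambda>i. P!i + s *\<^sub>R (x *\<^sub>R d i)) [0..<length P])) \<longlongrightarrow> p 0 x) (at_right 0)" for x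
  proof -
    have "((\<lambda>s. p 0 x + s *\<^sub>R p 1 x + s^2 *\<^sub>R p 2 x + s^3 *\<^sub>R p 3 x + s^3 *\<^sub>R R x s) \<longlongrightarrow>
        p 0 x + 0 *\<^sub>R p 1 x + 0^2 *\<^sub>R p 2 x + 0^3 *\<^sub>R p 3 x + 0^3 *\<^sub>R 0) (at_right 0)"
      by (intro tendsto_intros p(2))
    then have "((\<lambda>s. p 0 x + s *\<^sub>R p 1 x + s^2 *\<^sub>R p 2 x + s^3 *\<^sub>R p 3 x + s^3 *\<^sub>R R x s) \<longlongrightarrow> p 0 x) (at_right 0)"
      by simp
    moreover have "\<forall>\<^sub>F s in at_right 0. p 0 x + s *\<^sub>R p 1 x + s^2 *\<^sub>R p 2 x + s^3 *\<^sub>R p 3 x + s^3 *\<^sub>R R x s =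
        C (map (\<lambda>i. P!i + s *\<^sub>R (x *\<^sub>R d i)) [0..<length P])"
      using eventually_at_right_less[of "0::real"] by eventually_elim (simp only: C)
    ultimately show ?thesis
      by (rule Lim_transform_eventually)
  qed
  \<comment> \<open>At \<open>x = 0\<close> the path is constant; since \<open>p 0\<close> has
    degree 0, the limit found there is also the limit for \<open>x = 1\<close>.\<close>
  have "C P = p 0 0"
    using lim[of 0] by (simp add: map_nth tendsto_const_iff)
  also have "\<dots> = p 0 1"
    by (rule hpoly_0_const[OF p(1)]) simp
  finally show ?thesis
    using lim[of 1] by simp
qed

text \<open>
  Cutting off the last vertex may produce polygons of zero area; the direction \<open>d\<close> is chosen so
  that after moving the polygon a little along \<open>d\<close> this does not happen.
\<close>

lemma moment_euler:
  assumes triangles: "\<And>a b c. signed_area [a, b, c] \<noteq> 0 \<Longrightarrow>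
      moment [a, b, c] = edge_sum (euler_edge t) [a, b, c]"
    and "signed_area P \<noteq> 0"
  shows "moment P = edge_sum (euler_edge t) P"
  using assms(2)
proof (induction "length P" arbitrary: P)
  case 0
  then show ?case by (simp add: signed_area_def)
next
  case (Suc n)
  \<comment> \<open>\<open>n\<close> is one less than the number of vertices: for
    \<open>n \<le> 1\<close> the area vanishes, and \<open>n = 2\<close> is the triangle.\<close>
  consider "n = 0" | "n = 1" | "n = 2" | "n \<ge> 3" by linarith
  then show ?case
  proof cases
    case 1
    with Suc show ?thesis
      by (cases P) (simp_all add: signed_area_def)
  next
    case 2
    with Suc(2) have "length P = Suc (Suc 0)" by simp
    then obtain a b where "P = [a, b]"
      by (auto simp: length_Suc_conv)
    with Suc(3) show ?thesis
      by (simp add: signed_area_def numeral_2_eq_2)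
  next
    case 3
    with Suc(2) have "length P = Suc (Suc (Suc 0))" by simp
    then obtain a b c where "P = [a, b, c]"
      by (auto simp: length_Suc_conv)
    with Suc(3) show ?thesis by (simp add: triangles)
  next
    case 4
    \<comment> \<open>Vertices \<open>0\<close> to \<open>n - 2\<close> of the direction polygon lie
      on one axis and enclose no area; then \<open>e2\<close> adds the triangle
      \<open>0, e1, e2\<close> and \<open>- e1\<close> the triangle \<open>0, e2, - e1\<close>. The
      truncated, cut-off and full direction polygons thus have areas 1/2, 1/2 and 1.\<close>
    define d where "d i = (if i = 0 then 0 else if i < n - 1 then e1 else if i = n - 1 then e2 else - e1)" for i
    define V where "V s i = P!i + s *\<^sub>R d i" for s i
    have upt: "[0..<Suc n] = [0..<n] @ [n]" "[0..<n] = [0..<n - 1] @ [n - 1]"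
      using 4 upt_Suc_append[of 0 "n - 1"] by simp_all
    have ends: "hd (map f [0..<n]) = f 0" "last (map f [0..<n]) = f (n - 1)" for f :: "nat \<Rightarrow> real^2"
      using 4 by (simp_all add: hd_map last_map)
    have ends': "hd (map f [0..<n - 1]) = f 0" "last (map f [0..<n - 1]) = f (n - 2)" for f :: "nat \<Rightarrow> real^2"
      using 4 by (simp_all add: hd_map last_map numeral_2_eq_2)
    have nonempty: "map f [0..<n - 1] \<noteq> []" "map f [0..<n] \<noteq> []" for f :: "nat \<Rightarrow> real^2"
      using 4 by simp_all
    have split: "map f [0..<Suc n] = map f [0..<n] @ [f n]" "map f [0..<n] = map f [0..<n - 1] @ [f (n - 1)]"
      for f :: "nat \<Rightarrow> real^2"
      by (subst upt, simp only: map_append list.map)+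
    have "d i$2 = 0" if "i < n - 1" for i
      using that by (simp add: d_def)
    then have "signed_area (map d [0..<n - 1]) = 0"
      unfolding signed_area_def using 4 by (auto intro!: sum.neutral)
    moreover have "signed_area [d 0, d (n - 2), d (n - 1)] = 1/2"
      using 4 by (simp add: d_def signed_area_0 det2_def)
    ultimately have area_n: "signed_area (map d [0..<n]) = 1/2"
      unfolding split(2) signed_area_snoc[OF nonempty(1)] ends' by simp
    have "d 0 = 0" "d (n - 1) = e2" "d n = - e1"
      using 4 by (auto simp: d_def)
    then have area_tri: "signed_area (map d [0, n - 1, n]) = 1/2"
      by (simp add: signed_area_0 det2_def)
    have area_Suc: "signed_area (map d [0..<Suc n]) = 1"
      unfolding split(1) signed_area_snoc[OF nonempty(2)] ends area_n using area_tri by simp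
    \<comment> \<open>The area is quadratic in \<open>s\<close>, with the area of the direction
      polygon as leading coefficient.\<close>
    have ne: "\<forall>\<^sub>F s in at_right 0. signed_area (map (V s) js) \<noteq> 0" if "signed_area (map d js) \<noteq> 0" for js
    proof -
      obtain B where "\<And>s. signed_area (map (V s) js) =
          signed_area (map ((!) P) js) + s * B + s\<^sup>2 * signed_area (map d js)"
        using signed_area_perturb[where u="(!) P" and d=d and js=js] unfolding V_def[abs_def] by blast
      then show ?thesis
        using eventually_quadratic_nonzero[OF that] by simp
    qed
    have ne1: "\<forall>\<^sub>F s in at_right 0. signed_area (map (V s) [0..<n]) \<noteq> 0"
      and ne2: "\<forall>\<^sub>F s in at_right 0. signed_area (map (V s) [0, n - 1, n]) \<noteq> 0"
      and ne3: "\<forall>\<^sub>F s in at_right 0. signed_area (map (V s) [0..<Suc n]) \<noteq> 0"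
      by (rule ne; unfold area_n area_tri area_Suc; simp)+
    have ev: "\<forall>\<^sub>F s in at_right 0. moment (map (V s) [0..<Suc n]) = edge_sum (euler_edge t) (map (V s) [0..<Suc n])"
      using ne1 ne2 ne3
    proof eventually_elim
      case (elim s)
      let ?Q = "map (V s) [0..<n]" and ?x = "V s n"
      have R: "signed_area [hd ?Q, last ?Q, ?x] \<noteq> 0"
        unfolding ends using elim by simp
      have "moment (?Q @ [?x]) = moment ?Q + moment [hd ?Q, last ?Q, ?x]"
        using elim R 4 unfolding split(1) by (intro moment_snoc) simp_all
      also have "moment ?Q = edge_sum (euler_edge t) ?Q"
        using elim by (intro Suc(1)) simp_all
      also have "moment [hd ?Q, last ?Q, ?x] = edge_sum (euler_edge t) [hd ?Q, last ?Q, ?x]"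
        by (rule triangles[OF R])
      also have "edge_sum (euler_edge t) ?Q + edge_sum (euler_edge t) [hd ?Q, last ?Q, ?x] =
          edge_sum (euler_edge t) (?Q @ [?x])"
        by (rule edge_sum_snoc[OF nonempty(2) euler_edge_swap, symmetric])
      finally show ?case unfolding split(1) .
    qed
    have VP: "map (V s) [0..<Suc n] = map (\<lambda>i. P!i + s *\<^sub>R d i) [0..<length P]" for s
      unfolding V_def[abs_def] Suc(2) ..
    have "((\<lambda>s. signed_area (map (V s) [0..<Suc n])) \<longlongrightarrow> signed_area P) (at_right 0)"
    proof -
      obtain B where B: "\<And>s. signed_area (map (V s) [0..<Suc n]) =
          signed_area (map ((!) P) [0..<Suc n]) + s * B + s\<^sup>2 * signed_area (map d [0..<Suc n])"
        using signed_area_perturb[where u="(!) P" and d=d and js="[0..<Suc n]"] unfolding V_def[abs_def] by blast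
      have P: "map ((!) P) [0..<Suc n] = P"
        unfolding Suc(2) by (rule map_nth)
      have "((\<lambda>s. signed_area P + s * B + s\<^sup>2 * signed_area (map d [0..<Suc n])) \<longlongrightarrow>
          signed_area P + 0 * B + 0\<^sup>2 * signed_area (map d [0..<Suc n])) (at_right 0)"
        by (intro tendsto_intros)
      then show ?thesis unfolding B P by simp
    qed
    \<comment> \<open>Both sides of the identity for the perturbed polygon converge as
      \<open>s\<close> tends to 0, which gives the identity for \<open>P\<close> even when its own
      truncation has zero area.\<close>
    then have lim1: "((\<lambda>s. moment (map (V s) [0..<Suc n])) \<longlongrightarrow> moment P) (at_right 0)"
      unfolding moment_def VP by (intro tendsto_scaleR tendsto_center_along Suc(3))
    have "((\<lambda>s. V s i) \<longlongrightarrow> P!i + 0 *\<^sub>R d i) (at_right 0)" for i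
      unfolding V_def by (intro tendsto_intros)
    then have limV: "((\<lambda>s. V s i) \<longlongrightarrow> P!i) (at_right 0)" for i by simp
    have "edge_sum (euler_edge t) (map (V s) [0..<Suc n]) =
        (\<Sum>i<Suc n. euler_edge t (V s i) (V s (Suc i mod Suc n)))" for s
      unfolding edge_sum_def by (rule sum.cong) (simp_all del: upt_Suc)
    moreover have "((\<lambda>s. \<Sum>i<Suc n. euler_edge t (V s i) (V s (Suc i mod Suc n))) \<longlongrightarrow>
        (\<Sum>i<Suc n. euler_edge t (P!i) (P!(Suc i mod Suc n)))) (at_right 0)"
      by (intro tendsto_sum tendsto_euler_edge limV)
    ultimately have lim2: "((\<lambda>s. edge_sum (euler_edge t) (map (V s) [0..<Suc n])) \<longlongrightarrow>
        edge_sum (euler_edge t) P) (at_right 0)"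
      unfolding edge_sum_def[of _ P] Suc(2)[symmetric] by simp
    have "((\<lambda>s. edge_sum (euler_edge t) (map (V s) [0..<Suc n])) \<longlongrightarrow> moment P) (at_right 0)"
      using lim1 ev by (rule Lim_transform_eventually)
    from tendsto_unique[OF _ this lim2] show ?thesis by simp
  qed
qed

end

theorem theorem4:
  fixes C :: "(real^2) list \<Rightarrow> real^2"
  assumes cyclic: "\<And>P. signed_area P \<noteq> 0 \<Longrightarrow> C (rotate1 P) = C P"
    and analytic: "\<And>P. signed_area P \<noteq> 0 \<Longrightarrow> real_analytic_at C P"
    and dilations: "\<And>\<phi> P. dilation \<phi> \<Longrightarrow> signed_area P \<noteq> 0 \<Longrightarrow> C (map \<phi> P) = \<phi> (C P)"
    and archimedes: "\<And>P k X Q R.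
      0 < k \<Longrightarrow> k < length P \<Longrightarrow>
      Q = take (Suc k) P @ rev X \<Longrightarrow> R = P ! 0 # X @ drop k P \<Longrightarrow>
      signed_area P \<noteq> 0 \<Longrightarrow> signed_area Q \<noteq> 0 \<Longrightarrow> signed_area R \<noteq> 0 \<Longrightarrow>
      C P = (signed_area Q *\<^sub>R C Q + signed_area R *\<^sub>R C R) /\<^sub>R (signed_area Q + signed_area R)"
  shows "\<exists>t. \<forall>P. signed_area P \<noteq> 0 \<longrightarrow> C P = euler_center t P"
proof -
  interpret center C
    using assms by unfold_locales
  obtain t where t: "\<And>a b c. signed_area [a, b, c] \<noteq> 0 \<Longrightarrow>
      moment [a, b, c] = edge_sum (euler_edge t) [a, b, c]"
    by (rule moment_triangle_euler) blast
  have "C P = euler_center t P" if P: "signed_area P \<noteq> 0" for P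
  proof -
    have "signed_area P *\<^sub>R C P = signed_area P *\<^sub>R euler_center t P"
      using moment_euler[OF t P] euler_center_edge_sum[OF P] by (simp add: moment_def)
    with P show ?thesis by simp
  qed
  then show ?thesis by blast
qed

end
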